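(* Let $k$ be a field, $\Gamma$ an ordered group, $B$ a $k$-bialgebra, $FB$ a $\Gamma$-filtration of $B$ by bialgebras, and $\Lambda\subseteq\Gamma$ a subset. The categories $\mathcal F_\Lambda B$ and $\overline{\mathcal F}_\Lambda B$ have the structure of $k$-linear semi-Hopf categories.
   Context: An ordered group $(\Gamma,\le)$ is a group with a (partial) order such that $\alpha\le\beta$ and $\gamma\le\delta$ imply $\alpha\gamma\le\beta\delta$; $\Gamma^+=\{\gamma\mid e\le\gamma\}$. A $\Gamma$-filtration of $B$ by bialgebras is a family of subbialgebras $(F_\gamma B)_{\gamma\in\Gamma^+}$ of $B$ with $F_\gamma B\subseteq F_{\gamma'}B$ if $\gamma\le\gamma'$, $F_\gamma B\cdot F_{\gamma'}B\subseteq F_{\gamma\gamma'}B$, and $\Delta(F_\gamma B)\subseteq F_\gamma B\otimes F_\gamma B$. The filtered companion category $\mathcal F_\Lambda B$ has object set $\Lambda$ and $\operatorname{Hom}(\alpha,\beta)=F_{\beta\alpha^{-1}}B$ if $\alpha\le\beta$, $0$ otherwise, with composition given by multiplication in $B$. The extended companion category $\overline{\mathcal F}_\Lambda B$ has object set $\Lambda\sqcup\{\infty\}$, contains $\mathcal F_\Lambda B$ as a full subcategory, and has $\operatorname{Hom}(\alpha,\infty)=B$ for all $\alpha\in\Lambda\sqcup\{\infty\}$ and $\operatorname{Hom}(\infty,\alpha)=0$ for $\alpha\in\Lambda$, with composition given by multiplication in $B$. A $k$-linear semi-Hopf category is a category enriched over the monoidal category of $k$-coalgebras and coalgebra morphisms: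 its Hom-spaces are $k$-coalgebras, and composition and unit maps are coalgebra morphisms. Here the coalgebra structures on the Hom-spaces are those induced from $B$. *)

theory Defs
  imports "HOL-Algebra.Algebra"
begin

section \<open>Linear maps and tensor products of modules\<close>

definition linear_maps ::
  "('k, 'm) ring_scheme \<Rightarrow> ('k, 'v, 'p) module_scheme \<Rightarrow> ('k, 'w, 'q) module_scheme \<Rightarrow> ('v \<Rightarrow> 'w) set"
  where "linear_maps K V W = {f \<in> carrier V \<rightarrow> carrier W.
    (\<forall>x\<in>carrier V. \<forall>y\<in>carrier V. f (x \<oplus>\<^bsub>V\<^esub> y) = f x \<oplus>\<^bsub>W\<^esub> f y) \<and>
    (\<forall>c\<in>carrier K. \<forall>x\<in>carrier V. f (c \<odot>\<^bsub>V\<^esub> x) = c \<odot>\<^bsub>W\<^esub> f x)}"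

definition bilinear_maps ::
  "('k, 'm) ring_scheme \<Rightarrow> ('k, 'v, 'p) module_scheme \<Rightarrow> ('k, 'w, 'q) module_scheme
    \<Rightarrow> ('k, 'u, 'r) module_scheme \<Rightarrow> ('v \<Rightarrow> 'w \<Rightarrow> 'u) set"
  where "bilinear_maps K V W U = {\<phi>.
    (\<forall>v\<in>carrier V. \<phi> v \<in> linear_maps K W U) \<and>
    (\<forall>w\<in>carrier W. (\<lambda>v. \<phi> v w) \<in> linear_maps K V U)}"

text \<open>The library's module record extends the ring record; the fields \<open>mult\<close> and \<open>one\<close>
  carry no information for a plain module and are left undefined below.\<close>

definition free_module :: "('k, 'm) ring_scheme \<Rightarrow> 's set \<Rightarrow> ('k, 's \<Rightarrow> 'k) module"
  where "free_module K S =
    \<lparr>carrier = {x. finite {s. x s \<noteq> \<zero>\<^bsub>K\<^esub>} \<and> (\<forall>s\<in>S. x s \<in> carrier K) \<and> (\<forall>s. s \<notin> S \<longrightarrow> x s = \<zero>\<^bsub>K\<^esub>)},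
     monoid.mult = undefined, one = undefined,
     ring.zero = (\<lambda>_. \<zero>\<^bsub>K\<^esub>), ring.add = (\<lambda>x y s. x s \<oplus>\<^bsub>K\<^esub> y s),
     smult = (\<lambda>c x s. c \<otimes>\<^bsub>K\<^esub> x s)\<rparr>"

definition free_basis :: "('k, 'm) ring_scheme \<Rightarrow> 's \<Rightarrow> 's \<Rightarrow> 'k"
  where "free_basis K s = (\<lambda>t. if t = s then \<one>\<^bsub>K\<^esub> else \<zero>\<^bsub>K\<^esub>)"

definition generated_submodule ::
  "('k, 'm) ring_scheme \<Rightarrow> ('k, 'v, 'p) module_scheme \<Rightarrow> 'v set \<Rightarrow> 'v set"
  where "generated_submodule K M S = \<Inter>{N. submodule N K M \<and> S \<subseteq> N}"

text \<open>In the scalar multiplication of the quotient, adding \<open>N\<close> is only needed for scalars that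
  are not invertible (\<open>c \<odot> P\<close> need not be a whole coset then).\<close>

definition quotient_module ::
  "('k, 'v, 'p) module_scheme \<Rightarrow> 'v set \<Rightarrow> ('k, 'v set) module"
  where "quotient_module M N =
    \<lparr>carrier = a_rcosets\<^bsub>M\<^esub> N, monoid.mult = undefined, one = undefined,
     ring.zero = N, ring.add = (\<lambda>P Q. P <+>\<^bsub>M\<^esub> Q),
     smult = (\<lambda>c P. N <+>\<^bsub>M\<^esub> ((\<lambda>x. c \<odot>\<^bsub>M\<^esub> x) ` P))\<rparr>"

definition tensor_free ::
  "('k, 'm) ring_scheme \<Rightarrow> ('k, 'v, 'p) module_scheme \<Rightarrow> ('k, 'w, 'q) module_scheme
    \<Rightarrow> ('k, 'v \<times> 'w \<Rightarrow> 'k) module"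
  where "tensor_free K V W = free_module K (carrier V \<times> carrier W)"

definition tensor_relations ::
  "('k, 'm) ring_scheme \<Rightarrow> ('k, 'v, 'p) module_scheme \<Rightarrow> ('k, 'w, 'q) module_scheme
    \<Rightarrow> ('v \<times> 'w \<Rightarrow> 'k) set"
  where "tensor_relations K V W = (let A = tensor_free K V W; e = (\<lambda>v w. free_basis K (v, w)) in
    {e (v \<oplus>\<^bsub>V\<^esub> v') w \<ominus>\<^bsub>A\<^esub> (e v w \<oplus>\<^bsub>A\<^esub> e v' w) | v v' w.
       v \<in> carrier V \<and> v' \<in> carrier V \<and> w \<in> carrier W} \<union>
    {e v (w \<oplus>\<^bsub>W\<^esub> w') \<ominus>\<^bsub>A\<^esub> (e v w \<oplus>\<^bsub>A\<^esub> e v w') | v w w'.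
       v \<in> carrier V \<and> w \<in> carrier W \<and> w' \<in> carrier W} \<union>
    {e (c \<odot>\<^bsub>V\<^esub> v) w \<ominus>\<^bsub>A\<^esub> c \<odot>\<^bsub>A\<^esub> e v w | c v w.
       c \<in> carrier K \<and> v \<in> carrier V \<and> w \<in> carrier W} \<union>
    {e v (c \<odot>\<^bsub>W\<^esub> w) \<ominus>\<^bsub>A\<^esub> c \<odot>\<^bsub>A\<^esub> e v w | c v w.
       c \<in> carrier K \<and> v \<in> carrier V \<and> w \<in> carrier W})"

definition tensor_kernel ::
  "('k, 'm) ring_scheme \<Rightarrow> ('k, 'v, 'p) module_scheme \<Rightarrow> ('k, 'w, 'q) module_scheme
    \<Rightarrow> ('v \<times> 'w \<Rightarrow> 'k) set"
  where "tensor_kernel K V W = generated_submodule K (tensor_free K V W) (tensor_relations K V W)"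

type_synonym ('k, 'v, 'w) tensor = "('v \<times> 'w \<Rightarrow> 'k) set"

definition tensor ::
  "('k, 'm) ring_scheme \<Rightarrow> ('k, 'v, 'p) module_scheme \<Rightarrow> ('k, 'w, 'q) module_scheme
    \<Rightarrow> ('k, ('k, 'v, 'w) tensor) module"
  where "tensor K V W = quotient_module (tensor_free K V W) (tensor_kernel K V W)"

definition pure_tensor ::
  "('k, 'm) ring_scheme \<Rightarrow> ('k, 'v, 'p) module_scheme \<Rightarrow> ('k, 'w, 'q) module_scheme
    \<Rightarrow> 'v \<Rightarrow> 'w \<Rightarrow> ('k, 'v, 'w) tensor"
  where "pure_tensor K V W v w = tensor_kernel K V W +>\<^bsub>tensor_free K V W\<^esub> free_basis K (v, w)"

text \<open>The linear map from the tensor product of \<open>V\<close> and \<open>W\<close> to \<open>U\<close> induced by a bilinear map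
  \<open>\<phi>\<close>; for bilinear \<open>\<phi>\<close> the value does not depend on the representative \<open>x\<close> of the coset \<open>t\<close>.\<close>

definition tensor_lift ::
  "('k, 'm) ring_scheme \<Rightarrow> ('k, 'v, 'p) module_scheme \<Rightarrow> ('k, 'w, 'q) module_scheme
    \<Rightarrow> ('k, 'u, 'r) module_scheme \<Rightarrow> ('v \<Rightarrow> 'w \<Rightarrow> 'u) \<Rightarrow> ('k, 'v, 'w) tensor \<Rightarrow> 'u"
  where "tensor_lift K V W U \<phi> t =
    (THE u. \<exists>x\<in>t. u = (\<Oplus>\<^bsub>U\<^esub>p\<in>{p. x p \<noteq> \<zero>\<^bsub>K\<^esub>}. x p \<odot>\<^bsub>U\<^esub> \<phi> (fst p) (snd p)))"

definition tensor_map ::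
  "('k, 'm) ring_scheme \<Rightarrow> ('k, 'v, 'p) module_scheme \<Rightarrow> ('k, 'w, 'q) module_scheme
    \<Rightarrow> ('k, 'x, 'r) module_scheme \<Rightarrow> ('k, 'y, 's) module_scheme
    \<Rightarrow> ('v \<Rightarrow> 'x) \<Rightarrow> ('w \<Rightarrow> 'y) \<Rightarrow> ('k, 'v, 'w) tensor \<Rightarrow> ('k, 'x, 'y) tensor"
  where "tensor_map K V W P Q f g =
    tensor_lift K V W (tensor K P Q) (\<lambda>v w. pure_tensor K P Q (f v) (g w))"

text \<open>The associativity isomorphism \<open>(u \<otimes> v) \<otimes> w \<mapsto> u \<otimes> (v \<otimes> w)\<close>.\<close>

definition tensor_assoc ::
  "('k, 'm) ring_scheme \<Rightarrow> ('k, 'u, 'p) module_scheme \<Rightarrow> ('k, 'v, 'q) module_scheme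
    \<Rightarrow> ('k, 'w, 'r) module_scheme
    \<Rightarrow> ('k, ('k, 'u, 'v) tensor, 'w) tensor \<Rightarrow> ('k, 'u, ('k, 'v, 'w) tensor) tensor"
  where "tensor_assoc K U V W =
    (let T = tensor K U (tensor K V W) in
      tensor_lift K (tensor K U V) W T (\<lambda>s w.
        tensor_lift K U V T (\<lambda>u v. pure_tensor K U (tensor K V W) u (pure_tensor K V W v w)) s))"

text \<open>The interchange isomorphism \<open>(u \<otimes> v) \<otimes> (x \<otimes> y) \<mapsto> (u \<otimes> x) \<otimes> (v \<otimes> y)\<close>.\<close>

definition tensor_interchange ::
  "('k, 'm) ring_scheme \<Rightarrow> ('k, 'u, 'p) module_scheme \<Rightarrow> ('k, 'v, 'q) module_scheme
    \<Rightarrow> ('k, 'x, 'r) module_scheme \<Rightarrow> ('k, 'y, 's) module_scheme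
    \<Rightarrow> ('k, ('k, 'u, 'v) tensor, ('k, 'x, 'y) tensor) tensor
    \<Rightarrow> ('k, ('k, 'u, 'x) tensor, ('k, 'v, 'y) tensor) tensor"
  where "tensor_interchange K U V P Q =
    (let T = tensor K (tensor K U P) (tensor K V Q) in
      tensor_lift K (tensor K U V) (tensor K P Q) T (\<lambda>s t.
        tensor_lift K U V T (\<lambda>u v.
          tensor_lift K P Q T (\<lambda>x y.
            pure_tensor K (tensor K U P) (tensor K V Q)
              (pure_tensor K U P u x) (pure_tensor K V Q v y)) t) s))"


section \<open>Coalgebras and bialgebras\<close>

definition ground_module :: "('k, 'm) ring_scheme \<Rightarrow> ('k, 'k) module"
  where "ground_module K =
    \<lparr>carrier = carrier K, monoid.mult = monoid.mult K, one = \<one>\<^bsub>K\<^esub>,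
     ring.zero = \<zero>\<^bsub>K\<^esub>, ring.add = ring.add K, smult = monoid.mult K\<rparr>"

record ('k, 'v) coalgebra = "('k, 'v) module" +
  comult :: "'v \<Rightarrow> ('k, 'v, 'v) tensor"
  counit :: "'v \<Rightarrow> 'k"

locale coalgebra = K?: field K + C?: module K C
  for K :: "('k, 'm) ring_scheme" and C :: "('k, 'v, 'p) coalgebra_scheme" +
  assumes comult_linear: "comult C \<in> linear_maps K C (tensor K C C)"
    and counit_linear: "counit C \<in> linear_maps K C (ground_module K)"
    and coassociative: "c \<in> carrier C \<Longrightarrow>
      tensor_assoc K C C C
        (tensor_map K C C (tensor K C C) C (comult C) (\<lambda>x. x) (comult C c)) =
      tensor_map K C C C (tensor K C C) (\<lambda>x. x) (comult C) (comult C c)"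
    and counit_left: "c \<in> carrier C \<Longrightarrow>
      tensor_lift K C C C (\<lambda>x y. counit C x \<odot>\<^bsub>C\<^esub> y) (comult C c) = c"
    and counit_right: "c \<in> carrier C \<Longrightarrow>
      tensor_lift K C C C (\<lambda>x y. counit C y \<odot>\<^bsub>C\<^esub> x) (comult C c) = c"

definition coalgebra_hom ::
  "('k, 'm) ring_scheme \<Rightarrow> ('k, 'v, 'p) coalgebra_scheme \<Rightarrow> ('k, 'w, 'q) coalgebra_scheme
    \<Rightarrow> ('v \<Rightarrow> 'w) set"
  where "coalgebra_hom K C D = {f \<in> linear_maps K C D. \<forall>c\<in>carrier C.
    comult D (f c) = tensor_map K C C D D f f (comult C c) \<and> counit D (f c) = counit C c}"

text \<open>The tensor product and the unit object of the monoidal category of coalgebras.\<close>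

definition tensor_coalgebra ::
  "('k, 'm) ring_scheme \<Rightarrow> ('k, 'v, 'p) coalgebra_scheme \<Rightarrow> ('k, 'w, 'q) coalgebra_scheme
    \<Rightarrow> ('k, ('k, 'v, 'w) tensor) coalgebra"
  where "tensor_coalgebra K C D = module.extend (tensor K C D) (coalgebra.fields
    (\<lambda>t. tensor_interchange K C C D D
      (tensor_map K C D (tensor K C C) (tensor K D D) (comult C) (comult D) t))
    (tensor_lift K C D (ground_module K) (\<lambda>c d. counit C c \<otimes>\<^bsub>K\<^esub> counit D d)))"

definition unit_coalgebra :: "('k, 'm) ring_scheme \<Rightarrow> ('k, 'k) coalgebra"
  where "unit_coalgebra K = module.extend (ground_module K) (coalgebra.fields
    (\<lambda>c. pure_tensor K (ground_module K) (ground_module K) c \<one>\<^bsub>K\<^esub>)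
    (\<lambda>c. c))"

text \<open>The tensor product of two algebras, with multiplication
  \<open>(a \<otimes> b) (a' \<otimes> b') = a a' \<otimes> b b'\<close>.\<close>

definition tensor_algebra ::
  "('k, 'm) ring_scheme \<Rightarrow> ('k, 'v, 'p) module_scheme \<Rightarrow> ('k, 'w, 'q) module_scheme
    \<Rightarrow> ('k, ('k, 'v, 'w) tensor) module"
  where "tensor_algebra K A B = (tensor K A B)
    \<lparr>monoid.mult := \<lambda>s t. tensor_map K (tensor K A A) (tensor K B B) A B
        (tensor_lift K A A A (monoid.mult A)) (tensor_lift K B B B (monoid.mult B))
        (tensor_interchange K A B A B (pure_tensor K (tensor K A B) (tensor K A B) s t)),
     one := pure_tensor K A B \<one>\<^bsub>A\<^esub> \<one>\<^bsub>B\<^esub>\<rparr>"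

text \<open>The locale \<open>algebra\<close> of the library is restricted to commutative algebras.\<close>

locale bialgebra = coalgebra K B + B?: ring B
  for K :: "('k, 'm) ring_scheme" and B :: "('k, 'b, 'p) coalgebra_scheme" +
  assumes smult_mult_left: "\<lbrakk>c \<in> carrier K; x \<in> carrier B; y \<in> carrier B\<rbrakk> \<Longrightarrow>
      (c \<odot>\<^bsub>B\<^esub> x) \<otimes>\<^bsub>B\<^esub> y = c \<odot>\<^bsub>B\<^esub> (x \<otimes>\<^bsub>B\<^esub> y)"
    and smult_mult_right: "\<lbrakk>c \<in> carrier K; x \<in> carrier B; y \<in> carrier B\<rbrakk> \<Longrightarrow>
      x \<otimes>\<^bsub>B\<^esub> (c \<odot>\<^bsub>B\<^esub> y) = c \<odot>\<^bsub>B\<^esub> (x \<otimes>\<^bsub>B\<^esub> y)"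
    and comult_ring_hom: "comult B \<in> ring_hom B (tensor_algebra K B B)"
    and counit_ring_hom: "counit B \<in> ring_hom B K"


section \<open>Subcoalgebras and subbialgebras\<close>

text \<open>For a subspace \<open>C\<close> of \<open>B\<close>, the map induced by the inclusion from the tensor square of \<open>C\<close> to
  that of \<open>B\<close>. Over a field it is injective; its image is what is meant by the tensor square of
  \<open>C\<close> inside that of \<open>B\<close>.\<close>

definition tensor_square_inclusion ::
  "('k, 'm) ring_scheme \<Rightarrow> ('k, 'v, 'p) module_scheme \<Rightarrow> 'v set
    \<Rightarrow> ('k, 'v, 'v) tensor \<Rightarrow> ('k, 'v, 'v) tensor"
  where "tensor_square_inclusion K B C =
    tensor_map K (B\<lparr>carrier := C\<rparr>) (B\<lparr>carrier := C\<rparr>) B B (\<lambda>x. x) (\<lambda>x. x)"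

definition subcoalgebra ::
  "'v set \<Rightarrow> ('k, 'm) ring_scheme \<Rightarrow> ('k, 'v, 'p) coalgebra_scheme \<Rightarrow> bool"
  where "subcoalgebra C K B \<longleftrightarrow> submodule C K B \<and>
    comult B ` C \<subseteq> tensor_square_inclusion K B C `
      carrier (tensor K (B\<lparr>carrier := C\<rparr>) (B\<lparr>carrier := C\<rparr>))"

definition subbialgebra ::
  "'v set \<Rightarrow> ('k, 'm) ring_scheme \<Rightarrow> ('k, 'v, 'p) coalgebra_scheme \<Rightarrow> bool"
  where "subbialgebra C K B \<longleftrightarrow> subcoalgebra C K B \<and> subring C B"

text \<open>The coalgebra structure on a subcoalgebra \<open>C\<close> induced from \<open>B\<close>: the comultiplication is the
  corestriction of that of \<open>B\<close> along the injection of tensor squares.\<close>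

definition induced_coalgebra ::
  "('k, 'm) ring_scheme \<Rightarrow> ('k, 'v) coalgebra \<Rightarrow> 'v set \<Rightarrow> ('k, 'v) coalgebra"
  where "induced_coalgebra K B C = B\<lparr>carrier := C,
    comult := \<lambda>c. (THE t. t \<in> carrier (tensor K (B\<lparr>carrier := C\<rparr>) (B\<lparr>carrier := C\<rparr>)) \<and>
      tensor_square_inclusion K B C t = comult B c)\<rparr>"


section \<open>Semi-Hopf categories\<close>

text \<open>\<open>cmp H x y z g f\<close> is the composite of \<open>g\<close> in \<open>Hom H y z\<close> after \<open>f\<close> in \<open>Hom H x y\<close>.\<close>

record ('o, 'k, 'v) coalgebra_category =
  Obj :: "'o set"
  Hom :: "'o \<Rightarrow> 'o \<Rightarrow> ('k, 'v) coalgebra"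
  cmp :: "'o \<Rightarrow> 'o \<Rightarrow> 'o \<Rightarrow> 'v \<Rightarrow> 'v \<Rightarrow> 'v"
  ident :: "'o \<Rightarrow> 'v"

locale semi_hopf_category = K?: field K
  for K :: "('k, 'm) ring_scheme" and H :: "('o, 'k, 'v, 'p) coalgebra_category_scheme" +
  assumes coalgebra_Hom: "\<lbrakk>x \<in> Obj H; y \<in> Obj H\<rbrakk> \<Longrightarrow> coalgebra K (Hom H x y)"
    and cmp_bilinear: "\<lbrakk>x \<in> Obj H; y \<in> Obj H; z \<in> Obj H\<rbrakk> \<Longrightarrow>
      cmp H x y z \<in> bilinear_maps K (Hom H y z) (Hom H x y) (Hom H x z)"
    and ident_closed: "x \<in> Obj H \<Longrightarrow> ident H x \<in> carrier (Hom H x x)"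
    and cmp_assoc: "\<lbrakk>w \<in> Obj H; x \<in> Obj H; y \<in> Obj H; z \<in> Obj H;
      f \<in> carrier (Hom H w x); g \<in> carrier (Hom H x y); h \<in> carrier (Hom H y z)\<rbrakk> \<Longrightarrow>
      cmp H w x z (cmp H x y z h g) f = cmp H w y z h (cmp H w x y g f)"
    and cmp_ident_left: "\<lbrakk>x \<in> Obj H; y \<in> Obj H; f \<in> carrier (Hom H x y)\<rbrakk> \<Longrightarrow>
      cmp H x y y (ident H y) f = f"
    and cmp_ident_right: "\<lbrakk>x \<in> Obj H; y \<in> Obj H; f \<in> carrier (Hom H x y)\<rbrakk> \<Longrightarrow>
      cmp H x x y f (ident H x) = f"
    and cmp_coalgebra_hom: "\<lbrakk>x \<in> Obj H; y \<in> Obj H; z \<in> Obj H\<rbrakk> \<Longrightarrow>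
      tensor_lift K (Hom H y z) (Hom H x y) (Hom H x z) (cmp H x y z)
        \<in> coalgebra_hom K (tensor_coalgebra K (Hom H y z) (Hom H x y)) (Hom H x z)"
    and ident_coalgebra_hom: "x \<in> Obj H \<Longrightarrow>
      (\<lambda>c. c \<odot>\<^bsub>Hom H x x\<^esub> ident H x) \<in> coalgebra_hom K (unit_coalgebra K) (Hom H x x)"


section \<open>Filtrations and companion categories\<close>

locale ordered_group = group G
  for G :: "('g, 'n) monoid_scheme" (structure) +
  fixes leq :: "'g rel"
  assumes leq_partial_order: "partial_order_on (carrier G) leq"
    and mult_mono: "\<lbrakk>(\<alpha>, \<beta>) \<in> leq; (\<gamma>, \<delta>) \<in> leq\<rbrakk> \<Longrightarrow> (\<alpha> \<otimes> \<gamma>, \<beta> \<otimes> \<delta>) \<in> leq"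

definition nonneg_elements :: "('g, 'n) monoid_scheme \<Rightarrow> 'g rel \<Rightarrow> 'g set"
  where "nonneg_elements G leq = {\<gamma> \<in> carrier G. (\<one>\<^bsub>G\<^esub>, \<gamma>) \<in> leq}"

text \<open>The condition that the comultiplication maps \<open>F \<gamma>\<close> into its tensor square is part of
  \<open>subbialgebra\<close>.\<close>

locale bialgebra_filtration = ordered_group G leq + bialgebra K B
  for G :: "('g, 'n) monoid_scheme" (structure) and leq :: "'g rel"
    and K :: "('k, 'm) ring_scheme" and B :: "('k, 'b, 'p) coalgebra_scheme" +
  fixes F :: "'g \<Rightarrow> 'b set"
  assumes filtration_subbialgebra: "\<gamma> \<in> nonneg_elements G leq \<Longrightarrow> subbialgebra (F \<gamma>) K B"
    and filtration_mono: "\<lbrakk>\<gamma> \<in> nonneg_elements G leq; \<gamma>' \<in> nonneg_elements G leq; (\<gamma>, \<gamma>') \<in> leq\<rbrakk> \<Longrightarrow>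
      F \<gamma> \<subseteq> F \<gamma>'"
    and filtration_mult: "\<lbrakk>\<gamma> \<in> nonneg_elements G leq; \<gamma>' \<in> nonneg_elements G leq;
      x \<in> F \<gamma>; y \<in> F \<gamma>'\<rbrakk> \<Longrightarrow> x \<otimes>\<^bsub>B\<^esub> y \<in> F (\<gamma> \<otimes> \<gamma>')"

definition companion_space ::
  "('g, 'n) monoid_scheme \<Rightarrow> 'g rel \<Rightarrow> ('k, 'b) coalgebra \<Rightarrow> ('g \<Rightarrow> 'b set) \<Rightarrow> 'g \<Rightarrow> 'g \<Rightarrow> 'b set"
  where "companion_space G leq B F \<alpha> \<beta> =
    (if (\<alpha>, \<beta>) \<in> leq then F (\<beta> \<otimes>\<^bsub>G\<^esub> inv\<^bsub>G\<^esub> \<alpha>) else {\<zero>\<^bsub>B\<^esub>})"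

definition filtered_companion ::
  "('g, 'n) monoid_scheme \<Rightarrow> 'g rel \<Rightarrow> ('k, 'm) ring_scheme \<Rightarrow> ('k, 'b) coalgebra
    \<Rightarrow> ('g \<Rightarrow> 'b set) \<Rightarrow> 'g set \<Rightarrow> ('g, 'k, 'b) coalgebra_category"
  where "filtered_companion G leq K B F \<Lambda> =
    \<lparr>Obj = \<Lambda>,
     Hom = (\<lambda>\<alpha> \<beta>. induced_coalgebra K B (companion_space G leq B F \<alpha> \<beta>)),
     cmp = (\<lambda>_ _ _ g f. g \<otimes>\<^bsub>B\<^esub> f),
     ident = (\<lambda>_. \<one>\<^bsub>B\<^esub>)\<rparr>"

text \<open>The additional object \<open>\<infinity>\<close> of the extended companion category is \<open>None\<close>.\<close>

fun extended_companion_space ::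
  "('g, 'n) monoid_scheme \<Rightarrow> 'g rel \<Rightarrow> ('k, 'b) coalgebra \<Rightarrow> ('g \<Rightarrow> 'b set)
    \<Rightarrow> 'g option \<Rightarrow> 'g option \<Rightarrow> 'b set"
  where
    "extended_companion_space G leq B F (Some \<alpha>) (Some \<beta>) = companion_space G leq B F \<alpha> \<beta>"
  | "extended_companion_space G leq B F _ None = carrier B"
  | "extended_companion_space G leq B F None (Some \<beta>) = {\<zero>\<^bsub>B\<^esub>}"

definition extended_companion ::
  "('g, 'n) monoid_scheme \<Rightarrow> 'g rel \<Rightarrow> ('k, 'm) ring_scheme \<Rightarrow> ('k, 'b) coalgebra
    \<Rightarrow> ('g \<Rightarrow> 'b set) \<Rightarrow> 'g set \<Rightarrow> ('g option, 'k, 'b) coalgebra_category"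
  where "extended_companion G leq K B F \<Lambda> =
    \<lparr>Obj = insert None (Some ` \<Lambda>),
     Hom = (\<lambda>\<alpha> \<beta>. induced_coalgebra K B (extended_companion_space G leq B F \<alpha> \<beta>)),
     cmp = (\<lambda>_ _ _ g f. g \<otimes>\<^bsub>B\<^esub> f),
     ident = (\<lambda>_. \<one>\<^bsub>B\<^esub>)\<rparr>"

end

theory Submission
  imports Defs
begin

text \<open>
  All Hom-spaces of both categories are subcoalgebras of \<open>B\<close>, namely \<open>F \<gamma>\<close>, the zero space or \<open>B\<close>
  itself, and all structure maps are restrictions of those of \<open>B\<close>. Over a field a subspace \<open>C\<close> of
  \<open>B\<close> has a linear retraction, so the tensor square of \<open>C\<close> and its threefold analogue embed into
  those of \<open>B\<close>. Hence the coalgebra axioms for \<open>C\<close>, and the fact that multiplication and unit are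
  coalgebra morphisms between subcoalgebras, can be checked in tensor powers of \<open>B\<close>, where they are
  the coalgebra axioms of \<open>B\<close> and the multiplicativity of its comultiplication and counit.
\<close>

section \<open>Linear and bilinear maps\<close>

text \<open>A tensor is a concrete coset in a free module over the pairs of vectors, so the tensor
  square of \<open>C\<close> is not literally a subset of that of \<open>B\<close>. Every comparison
  passes through an explicit linear map, and identities between such maps are reduced to pure
  tensors by \<open>tensor_ext\<close>. The comultiplication of an induced coalgebra is a definite
  description. It denotes because \<open>comult B c\<close> lies in the image of the inclusion map,
  which is the subcoalgebra condition, and because that map is injective. Injectivity is where the
  field enters: over a general ring, tensoring an inclusion may create a kernel. Left inverses are
  carried along rather than mere injectivity, since they can be tensored once more and so settle the
  threefold case. Both categories are instances of one statement: a family of subcoalgebras that has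
  the unit on the diagonal and is closed under composable products gives a semi-Hopf category. The
  zero Hom-spaces fit in, because a product with a zero factor is zero and zero lies in every
  subspace.\<close>

lemma linear_mapsI:
  assumes "\<And>x. x \<in> carrier V \<Longrightarrow> f x \<in> carrier W"
    and "\<And>x y. \<lbrakk>x \<in> carrier V; y \<in> carrier V\<rbrakk> \<Longrightarrow> f (x \<oplus>\<^bsub>V\<^esub> y) = f x \<oplus>\<^bsub>W\<^esub> f y"
    and "\<And>c x. \<lbrakk>c \<in> carrier K; x \<in> carrier V\<rbrakk> \<Longrightarrow> f (c \<odot>\<^bsub>V\<^esub> x) = c \<odot>\<^bsub>W\<^esub> f x"
  shows "f \<in> linear_maps K V W"
  using assms unfolding linear_maps_def by auto

lemma linear_mapsD:
  assumes "f \<in> linear_maps K V W"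
  shows "x \<in> carrier V \<Longrightarrow> f x \<in> carrier W"
    and "\<lbrakk>x \<in> carrier V; y \<in> carrier V\<rbrakk> \<Longrightarrow> f (x \<oplus>\<^bsub>V\<^esub> y) = f x \<oplus>\<^bsub>W\<^esub> f y"
    and "\<lbrakk>c \<in> carrier K; x \<in> carrier V\<rbrakk> \<Longrightarrow> f (c \<odot>\<^bsub>V\<^esub> x) = c \<odot>\<^bsub>W\<^esub> f x"
  using assms unfolding linear_maps_def by auto

lemma linear_map_zero:
  assumes "module K V" "module K W" "f \<in> linear_maps K V W"
  shows "f \<zero>\<^bsub>V\<^esub> = \<zero>\<^bsub>W\<^esub>"
proof -
  interpret V: module K V by fact
  interpret W: module K W by fact
  have "f \<zero>\<^bsub>V\<^esub> = f (\<zero>\<^bsub>K\<^esub> \<odot>\<^bsub>V\<^esub> \<zero>\<^bsub>V\<^esub>)" by simp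
  also have "\<dots> = \<zero>\<^bsub>K\<^esub> \<odot>\<^bsub>W\<^esub> f \<zero>\<^bsub>V\<^esub>" by (rule linear_mapsD(3)[OF assms(3)]) auto
  also have "\<dots> = \<zero>\<^bsub>W\<^esub>" using linear_mapsD(1)[OF assms(3)] by simp
  finally show ?thesis .
qed

lemma linear_map_minus:
  assumes "module K V" "module K W" "f \<in> linear_maps K V W" "x \<in> carrier V" "y \<in> carrier V"
  shows "f (x \<ominus>\<^bsub>V\<^esub> y) = f x \<ominus>\<^bsub>W\<^esub> f y"
proof -
  interpret V: module K V by fact
  interpret W: module K W by fact
  have f: "f x \<in> carrier W" "f y \<in> carrier W" using linear_mapsD(1)[OF assms(3)] assms(4,5) by auto
  \<comment> \<open>Writing the difference with the scalar -1 lets additivity and homogeneity finish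
    the proof.\<close>
  have "x \<ominus>\<^bsub>V\<^esub> y = x \<oplus>\<^bsub>V\<^esub> (\<ominus>\<^bsub>K\<^esub> \<one>\<^bsub>K\<^esub>) \<odot>\<^bsub>V\<^esub> y"
    using assms(5) by (simp add: a_minus_def V.smult_l_minus)
  then have "f (x \<ominus>\<^bsub>V\<^esub> y) = f x \<oplus>\<^bsub>W\<^esub> (\<ominus>\<^bsub>K\<^esub> \<one>\<^bsub>K\<^esub>) \<odot>\<^bsub>W\<^esub> f y"
    using assms(4,5) by (simp add: linear_mapsD[OF assms(3)])
  also have "\<dots> = f x \<ominus>\<^bsub>W\<^esub> f y"
    using f by (simp add: a_minus_def W.smult_l_minus)
  finally show ?thesis .
qed

lemma linear_map_id: "(\<lambda>x. x) \<in> linear_maps K V V"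
  by (rule linear_mapsI) (rule refl | assumption)+

lemma linear_map_comp:
  assumes "f \<in> linear_maps K V W" "g \<in> linear_maps K W U"
  shows "(\<lambda>x. g (f x)) \<in> linear_maps K V U"
  by (rule linear_mapsI) (simp_all add: linear_mapsD[OF assms(1)] linear_mapsD[OF assms(2)])

lemma linear_map_add:
  assumes "module K W" "f \<in> linear_maps K V W" "g \<in> linear_maps K V W"
  shows "(\<lambda>x. f x \<oplus>\<^bsub>W\<^esub> g x) \<in> linear_maps K V W"
proof -
  interpret W: module K W by fact
  show ?thesis
    by (rule linear_mapsI)
      (simp_all add: linear_mapsD[OF assms(2)] linear_mapsD[OF assms(3)] W.smult_r_distr
        W.M.add.m_ac)
qed

text \<open>Homogeneity of the scaled map exchanges two scalars, so it rests on commutativity of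
  \<open>K\<close>.\<close>

lemma linear_map_smult:
  assumes "module K W" "f \<in> linear_maps K V W" "c \<in> carrier K"
  shows "(\<lambda>x. c \<odot>\<^bsub>W\<^esub> f x) \<in> linear_maps K V W"
proof -
  interpret W: module K W by fact
  show ?thesis
    by (rule linear_mapsI)
      (simp_all add: linear_mapsD[OF assms(2)] assms(3) W.smult_r_distr W.R.m_comm
        flip: W.smult_assoc1)
qed

lemma bilinear_mapsI:
  assumes "\<And>v w. \<lbrakk>v \<in> carrier V; w \<in> carrier W\<rbrakk> \<Longrightarrow> \<phi> v w \<in> carrier U"
    and "\<And>v v' w. \<lbrakk>v \<in> carrier V; v' \<in> carrier V; w \<in> carrier W\<rbrakk> \<Longrightarrow>
      \<phi> (v \<oplus>\<^bsub>V\<^esub> v') w = \<phi> v w \<oplus>\<^bsub>U\<^esub> \<phi> v' w"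
    and "\<And>v w w'. \<lbrakk>v \<in> carrier V; w \<in> carrier W; w' \<in> carrier W\<rbrakk> \<Longrightarrow>
      \<phi> v (w \<oplus>\<^bsub>W\<^esub> w') = \<phi> v w \<oplus>\<^bsub>U\<^esub> \<phi> v w'"
    and "\<And>c v w. \<lbrakk>c \<in> carrier K; v \<in> carrier V; w \<in> carrier W\<rbrakk> \<Longrightarrow>
      \<phi> (c \<odot>\<^bsub>V\<^esub> v) w = c \<odot>\<^bsub>U\<^esub> \<phi> v w"
    and "\<And>c v w. \<lbrakk>c \<in> carrier K; v \<in> carrier V; w \<in> carrier W\<rbrakk> \<Longrightarrow>
      \<phi> v (c \<odot>\<^bsub>W\<^esub> w) = c \<odot>\<^bsub>U\<^esub> \<phi> v w"
  shows "\<phi> \<in> bilinear_maps K V W U"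
  using assms unfolding bilinear_maps_def by (auto intro!: linear_mapsI)

lemma bilinear_mapsD:
  assumes "\<phi> \<in> bilinear_maps K V W U"
  shows "\<lbrakk>v \<in> carrier V; w \<in> carrier W\<rbrakk> \<Longrightarrow> \<phi> v w \<in> carrier U"
    and "\<lbrakk>v \<in> carrier V; v' \<in> carrier V; w \<in> carrier W\<rbrakk> \<Longrightarrow>
      \<phi> (v \<oplus>\<^bsub>V\<^esub> v') w = \<phi> v w \<oplus>\<^bsub>U\<^esub> \<phi> v' w"
    and "\<lbrakk>v \<in> carrier V; w \<in> carrier W; w' \<in> carrier W\<rbrakk> \<Longrightarrow>
      \<phi> v (w \<oplus>\<^bsub>W\<^esub> w') = \<phi> v w \<oplus>\<^bsub>U\<^esub> \<phi> v w'"
    and "\<lbrakk>c \<in> carrier K; v \<in> carrier V; w \<in> carrier W\<rbrakk> \<Longrightarrow>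
      \<phi> (c \<odot>\<^bsub>V\<^esub> v) w = c \<odot>\<^bsub>U\<^esub> \<phi> v w"
    and "\<lbrakk>c \<in> carrier K; v \<in> carrier V; w \<in> carrier W\<rbrakk> \<Longrightarrow>
      \<phi> v (c \<odot>\<^bsub>W\<^esub> w) = c \<odot>\<^bsub>U\<^esub> \<phi> v w"
    and "v \<in> carrier V \<Longrightarrow> \<phi> v \<in> linear_maps K W U"
    and "w \<in> carrier W \<Longrightarrow> (\<lambda>v. \<phi> v w) \<in> linear_maps K V U"
proof -
  show l: "v \<in> carrier V \<Longrightarrow> \<phi> v \<in> linear_maps K W U"
    and r: "w \<in> carrier W \<Longrightarrow> (\<lambda>v. \<phi> v w) \<in> linear_maps K V U" for v w
    using assms unfolding bilinear_maps_def by auto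
  show "\<lbrakk>v \<in> carrier V; w \<in> carrier W\<rbrakk> \<Longrightarrow> \<phi> v w \<in> carrier U"
    using linear_mapsD(1)[OF l] .
  show "\<lbrakk>v \<in> carrier V; v' \<in> carrier V; w \<in> carrier W\<rbrakk> \<Longrightarrow>
      \<phi> (v \<oplus>\<^bsub>V\<^esub> v') w = \<phi> v w \<oplus>\<^bsub>U\<^esub> \<phi> v' w"
    using linear_mapsD(2)[OF r] .
  show "\<lbrakk>v \<in> carrier V; w \<in> carrier W; w' \<in> carrier W\<rbrakk> \<Longrightarrow>
      \<phi> v (w \<oplus>\<^bsub>W\<^esub> w') = \<phi> v w \<oplus>\<^bsub>U\<^esub> \<phi> v w'"
    using linear_mapsD(2)[OF l] .
  show "\<lbrakk>c \<in> carrier K; v \<in> carrier V; w \<in> carrier W\<rbrakk> \<Longrightarrow>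
      \<phi> (c \<odot>\<^bsub>V\<^esub> v) w = c \<odot>\<^bsub>U\<^esub> \<phi> v w"
    using linear_mapsD(3)[OF r] .
  show "\<lbrakk>c \<in> carrier K; v \<in> carrier V; w \<in> carrier W\<rbrakk> \<Longrightarrow>
      \<phi> v (c \<odot>\<^bsub>W\<^esub> w) = c \<odot>\<^bsub>U\<^esub> \<phi> v w"
    using linear_mapsD(3)[OF l] .
qed

lemma bilinear_maps_comp:
  assumes "\<phi> \<in> bilinear_maps K V W U" "f \<in> linear_maps K V' V" "g \<in> linear_maps K W' W"
    "h \<in> linear_maps K U U'"
  shows "(\<lambda>v w. h (\<phi> (f v) (g w))) \<in> bilinear_maps K V' W' U'"
  by (rule bilinear_mapsI)
    (simp_all add: bilinear_mapsD[OF assms(1)] linear_mapsD[OF assms(2)] linear_mapsD[OF assms(3)]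
      linear_mapsD[OF assms(4)])


section \<open>Free modules and quotient modules\<close>

lemma module_free_module:
  assumes "cring K"
  shows "module K (free_module K S)"
proof -
  interpret cring K by fact
  let ?A = "free_module K S"
  \<comment> \<open>The definition asks for values in \<open>K\<close> only on \<open>S\<close>;
    since zero lies in \<open>K\<close>, this may be asked everywhere, which makes the module axioms
    pointwise.\<close>
  have mem: "x \<in> carrier ?A \<longleftrightarrow>
      finite {s. x s \<noteq> \<zero>\<^bsub>K\<^esub>} \<and> (\<forall>s. x s \<in> carrier K) \<and> (\<forall>s. s \<notin> S \<longrightarrow> x s = \<zero>\<^bsub>K\<^esub>)" for x
    unfolding free_module_def by simp (metis zero_closed)
  have ops: "x \<oplus>\<^bsub>?A\<^esub> y = (\<lambda>s. x s \<oplus>\<^bsub>K\<^esub> y s)" "c \<odot>\<^bsub>?A\<^esub> x = (\<lambda>s. c \<otimes>\<^bsub>K\<^esub> x s)"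
    "\<zero>\<^bsub>?A\<^esub> = (\<lambda>s. \<zero>\<^bsub>K\<^esub>)" for c x y
    by (simp_all add: free_module_def)
  have fin_add: "finite {s. x s \<oplus>\<^bsub>K\<^esub> y s \<noteq> \<zero>\<^bsub>K\<^esub>}"
    if "finite {s. x s \<noteq> \<zero>\<^bsub>K\<^esub>}" "finite {s. y s \<noteq> \<zero>\<^bsub>K\<^esub>}" for x y :: "'c \<Rightarrow> 'a"
    by (rule finite_subset[OF _ finite_UnI[OF that]]) auto
  have fin_smult: "finite {s. c \<otimes>\<^bsub>K\<^esub> x s \<noteq> \<zero>\<^bsub>K\<^esub>}"
    if "c \<in> carrier K" "finite {s. x s \<noteq> \<zero>\<^bsub>K\<^esub>}" for c and x :: "'c \<Rightarrow> 'a"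
    by (rule finite_subset[OF _ that(2)]) (use that(1) in auto)
  have opp: "(\<lambda>s. \<ominus>\<^bsub>K\<^esub> x s) \<in> carrier ?A" if x: "x \<in> carrier ?A" for x
  proof -
    have "{s. \<ominus>\<^bsub>K\<^esub> x s \<noteq> \<zero>\<^bsub>K\<^esub>} \<subseteq> {s. x s \<noteq> \<zero>\<^bsub>K\<^esub>}" by auto
    then have "finite {s. \<ominus>\<^bsub>K\<^esub> x s \<noteq> \<zero>\<^bsub>K\<^esub>}" by (rule finite_subset) (use x in \<open>simp add: mem\<close>)
    with x show ?thesis by (simp add: mem)
  qed
  show ?thesis
  proof (intro moduleI abelian_groupI)
    fix x assume x: "x \<in> carrier ?A"
    show "\<exists>y\<in>carrier ?A. y \<oplus>\<^bsub>?A\<^esub> x = \<zero>\<^bsub>?A\<^esub>"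
      by (rule bexI[OF _ opp[OF x]]) (use x in \<open>simp add: mem ops l_neg\<close>)
  qed (simp_all add: assms mem ops fin_add fin_smult fun_eq_iff a_ac l_distr r_distr m_assoc)
qed

lemma free_module_carrier:
  assumes "cring K" "x \<in> carrier (free_module K S)"
  shows "x s \<in> carrier K" and "s \<notin> S \<Longrightarrow> x s = \<zero>\<^bsub>K\<^esub>" and "finite {s. x s \<noteq> \<zero>\<^bsub>K\<^esub>}"
proof -
  interpret cring K by fact
  show "x s \<in> carrier K" "s \<notin> S \<Longrightarrow> x s = \<zero>\<^bsub>K\<^esub>" "finite {s. x s \<noteq> \<zero>\<^bsub>K\<^esub>}"
    using assms(2) by (cases "s \<in> S"; auto simp: free_module_def)+
qed

lemma free_basis_closed:
  assumes "cring K" "s \<in> S"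
  shows "free_basis K s \<in> carrier (free_module K S)"
proof -
  interpret cring K by fact
  have "finite {t. free_basis K s t \<noteq> \<zero>\<^bsub>K\<^esub>}"
    by (rule finite_subset[of _ "{s}"]) (auto simp: free_basis_def)
  then show ?thesis using assms(2) by (auto simp: free_module_def free_basis_def)
qed

text \<open>Induction runs over a finite set containing the support, not over the support itself, so
  that clearing one coordinate always leaves a vector covered by the smaller set.\<close>

lemma free_module_induct [consumes 2, case_names zero add]:
  assumes "cring K" and x: "x \<in> carrier (free_module K S)"
    and P0: "P \<zero>\<^bsub>free_module K S\<^esub>"
    and add: "\<And>c s x. \<lbrakk>c \<in> carrier K; s \<in> S; x \<in> carrier (free_module K S); P x\<rbrakk> \<Longrightarrow>
      P (c \<odot>\<^bsub>free_module K S\<^esub> free_basis K s \<oplus>\<^bsub>free_module K S\<^esub> x)"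
  shows "P x"
proof -
  interpret cring K by fact
  have "P x" if "finite A" "{s. x s \<noteq> \<zero>\<^bsub>K\<^esub>} \<subseteq> A" "x \<in> carrier (free_module K S)" for A x
    using that
  proof (induction A arbitrary: x)
    case empty
    then have "x = \<zero>\<^bsub>free_module K S\<^esub>" by (auto simp: free_module_def)
    then show ?case using P0 by simp
  next
    case (insert a A)
    define y where "y = x(a := \<zero>\<^bsub>K\<^esub>)"
    have sub: "{s. y s \<noteq> \<zero>\<^bsub>K\<^esub>} \<subseteq> {s. x s \<noteq> \<zero>\<^bsub>K\<^esub>}" by (auto simp: y_def)
    have y: "y \<in> carrier (free_module K S)"
      using insert.prems(2) finite_subset[OF sub] by (auto simp: free_module_def y_def)
    have "P y" using insert.prems(1) by (intro insert.IH y) (auto simp: y_def)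
    show ?case
    proof (cases "a \<in> S")
      case True
      have "x = x a \<odot>\<^bsub>free_module K S\<^esub> free_basis K a \<oplus>\<^bsub>free_module K S\<^esub> y"
        using free_module_carrier(1)[OF assms(1) insert.prems(2)]
        by (auto simp: free_module_def free_basis_def y_def)
      with add[OF free_module_carrier(1)[OF assms(1) insert.prems(2)] True y \<open>P y\<close>, of a]
      show ?thesis by simp
    next
      \<comment> \<open>The covering set may leave \<open>S\<close>; at such an index the coordinate
        is already zero and nothing is removed.\<close>
      case False
      then have "x = y" using free_module_carrier(2)[OF assms(1) insert.prems(2)]
        by (auto simp: y_def)
      with \<open>P y\<close> show ?thesis by simp
    qed
  qed
  from this[OF free_module_carrier(3)[OF assms(1) x] subset_refl x] show ?thesis .
qed

text \<open>The linear extension of a map given on the basis. The formula is the one inside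
  \<open>tensor_lift\<close>, so that \<open>tensor_lift\<close> can be folded into
  \<open>free_lift\<close> of a representative.\<close>

definition free_lift :: "('k, 'm) ring_scheme \<Rightarrow> ('k, 'u, 'r) module_scheme \<Rightarrow> ('s \<Rightarrow> 'u)
    \<Rightarrow> ('s \<Rightarrow> 'k) \<Rightarrow> 'u"
  where "free_lift K U \<phi> x = (\<Oplus>\<^bsub>U\<^esub>s\<in>{s. x s \<noteq> \<zero>\<^bsub>K\<^esub>}. x s \<odot>\<^bsub>U\<^esub> \<phi> s)"

text \<open>Supports change under addition and scaling, so sums over them cannot be combined
  termwise. Extra indices contribute zero scalars, hence any finite index set between the support
  and \<open>S\<close> may be used.\<close>

lemma free_lift_superset:
  assumes "module K U" "\<phi> \<in> S \<rightarrow> carrier U" "x \<in> carrier (free_module K S)"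
    and "finite A" "{s. x s \<noteq> \<zero>\<^bsub>K\<^esub>} \<subseteq> A" "A \<subseteq> S"
  shows "free_lift K U \<phi> x = (\<Oplus>\<^bsub>U\<^esub>s\<in>A. x s \<odot>\<^bsub>U\<^esub> \<phi> s)"
proof -
  interpret U: module K U by fact
  show ?thesis unfolding free_lift_def
    by (rule U.M.add.finprod_mono_neutral_cong_left)
      (use assms(2,4-) free_module_carrier[OF U.R.is_cring assms(3)]
        in \<open>auto simp: Pi_def subset_iff\<close>)
qed

lemma free_lift_linear:
  assumes "module K U" "\<phi> \<in> S \<rightarrow> carrier U"
  shows "free_lift K U \<phi> \<in> linear_maps K (free_module K S) U"
proof -
  interpret U: module K U by fact
  interpret A: module K "free_module K S" by (rule module_free_module) (rule U.R.is_cring)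
  note sup = free_lift_superset[OF assms]
  note car = free_module_carrier[OF U.R.is_cring]
  have supp: "{s. x s \<noteq> \<zero>\<^bsub>K\<^esub>} \<subseteq> S" if "x \<in> carrier (free_module K S)" for x
    using car(2)[OF that] by auto
  show ?thesis
  proof (rule linear_mapsI)
    fix x assume x: "x \<in> carrier (free_module K S)"
    show "free_lift K U \<phi> x \<in> carrier U"
      unfolding sup[OF x car(3)[OF x] subset_refl supp[OF x]]
      using car(1)[OF x] supp[OF x] assms(2) by (intro U.M.add.finprod_closed) auto
    fix y assume y: "y \<in> carrier (free_module K S)"
    \<comment> \<open>The union of both supports serves as common index set for \<open>x\<close>,
      \<open>y\<close> and their sum, whose own support may be smaller by cancellation.\<close>
    let ?A = "{s. x s \<noteq> \<zero>\<^bsub>K\<^esub>} \<union> {s. y s \<noteq> \<zero>\<^bsub>K\<^esub>}"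
    have A: "finite ?A" "?A \<subseteq> S" using car(3) supp x y by auto
    have xy: "(x \<oplus>\<^bsub>free_module K S\<^esub> y) s = x s \<oplus>\<^bsub>K\<^esub> y s" for s by (simp add: free_module_def)
    have "free_lift K U \<phi> (x \<oplus>\<^bsub>free_module K S\<^esub> y) =
        (\<Oplus>\<^bsub>U\<^esub>s\<in>?A. (x \<oplus>\<^bsub>free_module K S\<^esub> y) s \<odot>\<^bsub>U\<^esub> \<phi> s)"
      using x y A by (intro sup) (auto simp: xy)
    also have "\<dots> = (\<Oplus>\<^bsub>U\<^esub>s\<in>?A. x s \<odot>\<^bsub>U\<^esub> \<phi> s \<oplus>\<^bsub>U\<^esub> y s \<odot>\<^bsub>U\<^esub> \<phi> s)"
      using A(2) assms(2) car(1)[OF x] car(1)[OF y]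
      by (intro U.M.add.finprod_cong') (auto simp: xy U.smult_l_distr Pi_def subset_iff)
    also have "\<dots> = (\<Oplus>\<^bsub>U\<^esub>s\<in>?A. x s \<odot>\<^bsub>U\<^esub> \<phi> s) \<oplus>\<^bsub>U\<^esub> (\<Oplus>\<^bsub>U\<^esub>s\<in>?A. y s \<odot>\<^bsub>U\<^esub> \<phi> s)"
      using A(2) assms(2) car(1)[OF x] car(1)[OF y]
      by (intro U.M.add.finprod_multf) (auto simp: Pi_def subset_iff)
    also have "\<dots> = free_lift K U \<phi> x \<oplus>\<^bsub>U\<^esub> free_lift K U \<phi> y"
      using sup[OF x A(1) _ A(2)] sup[OF y A(1) _ A(2)] by simp
    finally show "free_lift K U \<phi> (x \<oplus>\<^bsub>free_module K S\<^esub> y) =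
        free_lift K U \<phi> x \<oplus>\<^bsub>U\<^esub> free_lift K U \<phi> y" .
  next
    fix c x assume c: "c \<in> carrier K" and x: "x \<in> carrier (free_module K S)"
    let ?A = "{s. x s \<noteq> \<zero>\<^bsub>K\<^esub>}"
    have A: "finite ?A" "?A \<subseteq> S" using car(3) supp x by auto
    have cx: "(c \<odot>\<^bsub>free_module K S\<^esub> x) s = c \<otimes>\<^bsub>K\<^esub> x s" for s by (simp add: free_module_def)
    have "free_lift K U \<phi> (c \<odot>\<^bsub>free_module K S\<^esub> x) =
        (\<Oplus>\<^bsub>U\<^esub>s\<in>?A. (c \<odot>\<^bsub>free_module K S\<^esub> x) s \<odot>\<^bsub>U\<^esub> \<phi> s)"
      using x A c by (intro sup) (auto simp: cx)
    also have "\<dots> = (\<Oplus>\<^bsub>U\<^esub>s\<in>?A. c \<odot>\<^bsub>U\<^esub> (x s \<odot>\<^bsub>U\<^esub> \<phi> s))"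
      using A(2) assms(2) car(1)[OF x] c
      by (intro U.M.add.finprod_cong') (auto simp: cx U.smult_assoc1 Pi_def subset_iff)
    also have "\<dots> = c \<odot>\<^bsub>U\<^esub> free_lift K U \<phi> x"
      unfolding sup[OF x A(1) subset_refl A(2)]
      using A(2) assms(2) car(1)[OF x]
      by (intro U.finsum_smult_ldistr[symmetric] A(1) c) (auto simp: Pi_def subset_iff)
    finally show "free_lift K U \<phi> (c \<odot>\<^bsub>free_module K S\<^esub> x) = c \<odot>\<^bsub>U\<^esub> free_lift K U \<phi> x" .
  qed
qed

text \<open>Summing over the singleton instead of the support also covers the zero ring, where the
  support of a basis vector is empty.\<close>

lemma free_lift_basis:
  assumes "module K U" "\<phi> \<in> S \<rightarrow> carrier U" "s \<in> S"
  shows "free_lift K U \<phi> (free_basis K s) = \<phi> s"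
proof -
  interpret U: module K U by fact
  have "free_lift K U \<phi> (free_basis K s) = (\<Oplus>\<^bsub>U\<^esub>t\<in>{s}. free_basis K s t \<odot>\<^bsub>U\<^esub> \<phi> t)"
    by (rule free_lift_superset[OF assms(1,2) free_basis_closed[OF U.R.is_cring assms(3)]])
      (auto simp: free_basis_def assms(3))
  also have "\<dots> = \<phi> s"
    using assms(2,3) by (auto simp: free_basis_def Pi_def)
  finally show ?thesis .
qed

section \<open>Quotients of a module by a submodule\<close>

context
  fixes K :: "('k, 'm) ring_scheme" and M :: "('k, 'v, 'p) module_scheme" and N
  assumes M: "module K M" and N: "submodule N K M"
begin

interpretation M: module K M by (rule M)
interpretation N: submodule N K M by (rule N)
text \<open>Addition is commutative, so \<open>N\<close> is a normal additive subgroup and the coset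
  calculus for abelian groups applies.\<close>

interpretation N: abelian_subgroup N M
  by (rule abelian_subgroupI3) (auto intro: additive_subgroup.intro N.subgroup_axioms M.abelian_group_axioms)

lemma quotient_module_carrier:
  "carrier (quotient_module M N) = (\<lambda>x. N +>\<^bsub>M\<^esub> x) ` carrier M"
  by (auto simp: quotient_module_def A_RCOSETS_def')

lemma quotient_module_add:
  assumes "x \<in> carrier M" "y \<in> carrier M"
  shows "(N +>\<^bsub>M\<^esub> x) \<oplus>\<^bsub>quotient_module M N\<^esub> (N +>\<^bsub>M\<^esub> y) = N +>\<^bsub>M\<^esub> (x \<oplus>\<^bsub>M\<^esub> y)"
  using N.a_rcos_sum[OF assms] by (simp add: quotient_module_def)

text \<open>The scaled coset lies in the coset of \<open>c x\<close> and contains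
  \<open>c x\<close>; adding \<open>N\<close> fills it up to the whole coset.\<close>

lemma quotient_module_smult:
  assumes "c \<in> carrier K" "x \<in> carrier M"
  shows "c \<odot>\<^bsub>quotient_module M N\<^esub> (N +>\<^bsub>M\<^esub> x) = N +>\<^bsub>M\<^esub> (c \<odot>\<^bsub>M\<^esub> x)"
proof -
  have "N <+>\<^bsub>M\<^esub> ((\<lambda>x. c \<odot>\<^bsub>M\<^esub> x) ` (N +>\<^bsub>M\<^esub> x)) = N +>\<^bsub>M\<^esub> (c \<odot>\<^bsub>M\<^esub> x)" (is "?L = ?R")
  proof (intro equalityI subsetI)
    fix z assume "z \<in> ?L"
    then obtain n m where *: "n \<in> N" "m \<in> N" "z = n \<oplus>\<^bsub>M\<^esub> c \<odot>\<^bsub>M\<^esub> (m \<oplus>\<^bsub>M\<^esub> x)"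
      by (auto simp: set_add_def' a_r_coset_def')
    then have "z = (n \<oplus>\<^bsub>M\<^esub> c \<odot>\<^bsub>M\<^esub> m) \<oplus>\<^bsub>M\<^esub> c \<odot>\<^bsub>M\<^esub> x"
      using assms by (simp add: M.smult_r_distr M.M.a_assoc)
    moreover have "n \<oplus>\<^bsub>M\<^esub> c \<odot>\<^bsub>M\<^esub> m \<in> N" using * assms by simp
    ultimately show "z \<in> ?R" by (auto simp: a_r_coset_def')
  next
    fix z assume "z \<in> ?R"
    then obtain n where *: "n \<in> N" "z = n \<oplus>\<^bsub>M\<^esub> c \<odot>\<^bsub>M\<^esub> x" by (auto simp: a_r_coset_def')
    moreover have "x \<in> N +>\<^bsub>M\<^esub> x" using N.a_rcos_self[OF assms(2)] .
    ultimately show "z \<in> ?L" by (force simp: set_add_def')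
  qed
  then show ?thesis by (simp add: quotient_module_def)
qed

text \<open>Written as the coset of zero, the neutral element falls under the same rewriting of
  cosets as every other element of the quotient.\<close>

lemma quotient_module_zero: "\<zero>\<^bsub>quotient_module M N\<^esub> = N +>\<^bsub>M\<^esub> \<zero>\<^bsub>M\<^esub>"
  using M.M.a_coset_add_zero[OF N.a_subset] by (simp add: quotient_module_def)

lemma module_quotient_module: "module K (quotient_module M N)"
proof (intro moduleI abelian_groupI M.R.is_cring)
  fix P assume "P \<in> carrier (quotient_module M N)"
  then obtain x where x: "x \<in> carrier M" "P = N +>\<^bsub>M\<^esub> x" by (auto simp: quotient_module_carrier)
  have "(N +>\<^bsub>M\<^esub> (\<ominus>\<^bsub>M\<^esub> x)) \<oplus>\<^bsub>quotient_module M N\<^esub> P = \<zero>\<^bsub>quotient_module M N\<^esub>"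
    using x by (simp add: quotient_module_add quotient_module_zero M.M.l_neg)
  then show "\<exists>Q\<in>carrier (quotient_module M N). Q \<oplus>\<^bsub>quotient_module M N\<^esub> P = \<zero>\<^bsub>quotient_module M N\<^esub>"
    using x(1) by (auto simp: quotient_module_carrier)
qed (auto simp: quotient_module_carrier quotient_module_add quotient_module_smult quotient_module_zero
      M.smult_l_distr M.smult_r_distr M.smult_assoc1 M.M.a_ac)

lemma quotient_module_proj: "(\<lambda>x. N +>\<^bsub>M\<^esub> x) \<in> linear_maps K M (quotient_module M N)"
  by (rule linear_mapsI) (auto simp: quotient_module_carrier quotient_module_add quotient_module_smult)

text \<open>This form turns membership of a relation in \<open>tensor_kernel\<close> into an
  equation between pure tensors.\<close>

lemma quotient_module_coset_eqI:
  assumes "x \<in> carrier M" "y \<in> carrier M" "x \<ominus>\<^bsub>M\<^esub> y \<in> N"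
  shows "N +>\<^bsub>M\<^esub> x = N +>\<^bsub>M\<^esub> y"
proof -
  have "x = (x \<ominus>\<^bsub>M\<^esub> y) \<oplus>\<^bsub>M\<^esub> y"
    using assms(1,2) by (simp add: a_minus_def M.M.a_assoc M.M.l_neg)
  then have "x \<in> N +>\<^bsub>M\<^esub> y" using assms(3) by (auto simp: a_r_coset_def')
  from M.M.a_repr_independence[OF this assms(2) N.subgroup_axioms] show ?thesis ..
qed

text \<open>Independence of the representative, needed for the definite description in
  \<open>tensor_lift\<close>.\<close>

lemma linear_map_coset:
  assumes "module K U" "f \<in> linear_maps K M U" "\<And>n. n \<in> N \<Longrightarrow> f n = \<zero>\<^bsub>U\<^esub>"
    and "x \<in> carrier M" "y \<in> N +>\<^bsub>M\<^esub> x"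
  shows "f y = f x"
proof -
  interpret U: module K U by fact
  from assms(5) obtain n where "n \<in> N" "y = n \<oplus>\<^bsub>M\<^esub> x" by (auto simp: a_r_coset_def')
  then show ?thesis
    using assms(3,4) linear_mapsD(1,2)[OF assms(2)] N.a_subset by auto
qed

end

section \<open>Tensor products\<close>

lemma submodule_generated_submodule:
  assumes "module K M" "S \<subseteq> carrier M"
  shows "submodule (generated_submodule K M S) K M"
proof -
  interpret M: module K M by fact
  \<comment> \<open>The family being intersected must have a member inside the module, since an
    empty intersection would be the whole type.\<close>
  have "carrier M \<in> {N. submodule N K M \<and> S \<subseteq> N}"
    using assms(2) M.carrier_is_submodule by auto
  moreover have "N \<subseteq> carrier M" "\<zero>\<^bsub>M\<^esub> \<in> N" if "submodule N K M" for N
    using M.submoduleE[OF that] submodule.axioms(1)[OF that] subgroup.one_closed by fastforce+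
  ultimately show ?thesis
    unfolding generated_submodule_def
    by (intro M.submoduleI) (auto simp: M.submoduleE)
qed

lemma generated_submodule_superset: "S \<subseteq> generated_submodule K M S"
  unfolding generated_submodule_def by auto

text \<open>The kernel of \<open>f\<close> is one of the submodules containing \<open>S\<close>, so
  the intersection of all of them lies in it.\<close>

lemma linear_map_generated_zero:
  assumes "module K M" "module K U" "f \<in> linear_maps K M U" "S \<subseteq> carrier M"
    and "\<And>x. x \<in> S \<Longrightarrow> f x = \<zero>\<^bsub>U\<^esub>" and "x \<in> generated_submodule K M S"
  shows "f x = \<zero>\<^bsub>U\<^esub>"
proof -
  interpret M: module K M by fact
  interpret U: module K U by fact
  have "submodule {x \<in> carrier M. f x = \<zero>\<^bsub>U\<^esub>} K M"
  proof (rule M.submoduleI)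
    fix a assume "a \<in> {x \<in> carrier M. f x = \<zero>\<^bsub>U\<^esub>}"
    then show "\<ominus>\<^bsub>M\<^esub> a \<in> {x \<in> carrier M. f x = \<zero>\<^bsub>U\<^esub>}"
      using linear_map_minus[OF assms(1-3) M.M.zero_closed, of a] linear_map_zero[OF assms(1-3)]
      by (simp add: a_minus_def)
  qed (auto simp: linear_mapsD[OF assms(3)] linear_map_zero[OF assms(1-3)])
  with assms(4,5) have "generated_submodule K M S \<subseteq> {x \<in> carrier M. f x = \<zero>\<^bsub>U\<^esub>}"
    unfolding generated_submodule_def by blast
  with assms(6) show ?thesis by auto
qed

lemma tensor_relationsI:
  assumes "v \<in> carrier V" "w \<in> carrier W"
  shows "v' \<in> carrier V \<Longrightarrow> free_basis K (v \<oplus>\<^bsub>V\<^esub> v', w) \<ominus>\<^bsub>tensor_free K V W\<^esub>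
      (free_basis K (v, w) \<oplus>\<^bsub>tensor_free K V W\<^esub> free_basis K (v', w)) \<in> tensor_relations K V W"
    and "w' \<in> carrier W \<Longrightarrow> free_basis K (v, w \<oplus>\<^bsub>W\<^esub> w') \<ominus>\<^bsub>tensor_free K V W\<^esub>
      (free_basis K (v, w) \<oplus>\<^bsub>tensor_free K V W\<^esub> free_basis K (v, w')) \<in> tensor_relations K V W"
    and "c \<in> carrier K \<Longrightarrow> free_basis K (c \<odot>\<^bsub>V\<^esub> v, w) \<ominus>\<^bsub>tensor_free K V W\<^esub>
      c \<odot>\<^bsub>tensor_free K V W\<^esub> free_basis K (v, w) \<in> tensor_relations K V W"
    and "c \<in> carrier K \<Longrightarrow> free_basis K (v, c \<odot>\<^bsub>W\<^esub> w) \<ominus>\<^bsub>tensor_free K V W\<^esub>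
      c \<odot>\<^bsub>tensor_free K V W\<^esub> free_basis K (v, w) \<in> tensor_relations K V W"
  using assms unfolding tensor_relations_def Let_def by blast+

lemma tensor_relationsE:
  assumes "x \<in> tensor_relations K V W"
  obtains v v' w where "v \<in> carrier V" "v' \<in> carrier V" "w \<in> carrier W"
      "x = free_basis K (v \<oplus>\<^bsub>V\<^esub> v', w) \<ominus>\<^bsub>tensor_free K V W\<^esub>
        (free_basis K (v, w) \<oplus>\<^bsub>tensor_free K V W\<^esub> free_basis K (v', w))"
    | v w w' where "v \<in> carrier V" "w \<in> carrier W" "w' \<in> carrier W"
      "x = free_basis K (v, w \<oplus>\<^bsub>W\<^esub> w') \<ominus>\<^bsub>tensor_free K V W\<^esub>
        (free_basis K (v, w) \<oplus>\<^bsub>tensor_free K V W\<^esub> free_basis K (v, w'))"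
    | c v w where "c \<in> carrier K" "v \<in> carrier V" "w \<in> carrier W"
      "x = free_basis K (c \<odot>\<^bsub>V\<^esub> v, w) \<ominus>\<^bsub>tensor_free K V W\<^esub>
        c \<odot>\<^bsub>tensor_free K V W\<^esub> free_basis K (v, w)"
    | c v w where "c \<in> carrier K" "v \<in> carrier V" "w \<in> carrier W"
      "x = free_basis K (v, c \<odot>\<^bsub>W\<^esub> w) \<ominus>\<^bsub>tensor_free K V W\<^esub>
        c \<odot>\<^bsub>tensor_free K V W\<^esub> free_basis K (v, w)"
  using assms unfolding tensor_relations_def Let_def by blast

lemma tensor_relations_closed:
  assumes "module K V" "module K W"
  shows "tensor_relations K V W \<subseteq> carrier (tensor_free K V W)"
proof -
  interpret V: module K V by fact
  interpret W: module K W by fact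
  interpret A: module K "tensor_free K V W"
    unfolding tensor_free_def by (rule module_free_module[OF V.R.is_cring])
  have "free_basis K (v, w) \<in> carrier (tensor_free K V W)" if "v \<in> carrier V" "w \<in> carrier W" for v w
    unfolding tensor_free_def using that by (intro free_basis_closed V.R.is_cring) auto
  then show ?thesis by (auto elim!: tensor_relationsE)
qed

lemma module_tensor_free: "module K V \<Longrightarrow> module K (tensor_free K V W)"
  unfolding tensor_free_def by (rule module_free_module) (rule module.axioms(1))

lemma submodule_tensor_kernel:
  assumes "module K V" "module K W"
  shows "submodule (tensor_kernel K V W) K (tensor_free K V W)"
  unfolding tensor_kernel_def
  by (intro submodule_generated_submodule module_tensor_free tensor_relations_closed assms)

lemma module_tensor:
  assumes "module K V" "module K W"
  shows "module K (tensor K V W)"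
  unfolding tensor_def
  by (intro module_quotient_module module_tensor_free submodule_tensor_kernel assms)

lemma tensor_free_basis_closed:
  assumes "module K V" "v \<in> carrier V" "w \<in> carrier W"
  shows "free_basis K (v, w) \<in> carrier (tensor_free K V W)"
  unfolding tensor_free_def using assms(2,3) by (intro free_basis_closed module.axioms(1)[OF assms(1)]) auto

text \<open>Each of the four families of relations yields exactly one of the additivity and
  homogeneity laws.\<close>

lemma pure_tensor_bilinear:
  assumes V: "module K V" and W: "module K W"
  shows "pure_tensor K V W \<in> bilinear_maps K V W (tensor K V W)"
proof -
  interpret V: module K V by fact
  interpret W: module K W by fact
  interpret A: module K "tensor_free K V W" by (rule module_tensor_free[OF V])
  note N = submodule_tensor_kernel[OF V W]
  have rel: "tensor_relations K V W \<subseteq> tensor_kernel K V W"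
    unfolding tensor_kernel_def by (rule generated_submodule_superset)
  note e = tensor_free_basis_closed[OF V]
  note q = quotient_module_add[OF A.module_axioms N] quotient_module_smult[OF A.module_axioms N]
    quotient_module_carrier[OF A.module_axioms N]
  note eq = quotient_module_coset_eqI[OF A.module_axioms N]
  show ?thesis
    unfolding tensor_def pure_tensor_def
  proof (rule bilinear_mapsI, goal_cases)
    case (1 v w)
    then show ?case by (simp add: q) (intro imageI e)
  next
    case (2 v v' w)
    then show ?case
      by (simp add: q e) (intro eq subsetD[OF rel] tensor_relationsI(1); simp add: e)
  next
    case (3 v w w')
    then show ?case
      by (simp add: q e) (intro eq subsetD[OF rel] tensor_relationsI(2); simp add: e)
  next
    case (4 c v w)
    then show ?case
      by (simp add: q e) (intro eq subsetD[OF rel] tensor_relationsI(3); simp add: e)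
  next
    case (5 c v w)
    then show ?case
      by (simp add: q e) (intro eq subsetD[OF rel] tensor_relationsI(4); simp add: e)
  qed
qed

lemmas pure_tensor_closed = bilinear_mapsD(1)[OF pure_tensor_bilinear]

text \<open>A representative is a finite combination of basis pairs. Its coefficients are absorbed
  into the left factors, so every tensor is a plain sum of pure tensors and no scalar case is
  needed.\<close>

lemma tensor_induct [consumes 3, case_names zero add]:
  assumes V: "module K V" and W: "module K W" and t: "t \<in> carrier (tensor K V W)"
    and P0: "P \<zero>\<^bsub>tensor K V W\<^esub>"
    and add: "\<And>v w t. \<lbrakk>v \<in> carrier V; w \<in> carrier W; t \<in> carrier (tensor K V W); P t\<rbrakk> \<Longrightarrow>
      P (pure_tensor K V W v w \<oplus>\<^bsub>tensor K V W\<^esub> t)"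
  shows "P t"
proof -
  interpret V: module K V by fact
  interpret A: module K "tensor_free K V W" by (rule module_tensor_free[OF V])
  let ?A = "tensor_free K V W" and ?N = "tensor_kernel K V W"
  note N = submodule_tensor_kernel[OF V W]
  note proj = quotient_module_proj[OF A.module_axioms N, folded tensor_def]
  from t obtain x where x: "x \<in> carrier ?A" "t = ?N +>\<^bsub>?A\<^esub> x"
    unfolding tensor_def quotient_module_carrier[OF A.module_axioms N] by auto
  have "P (?N +>\<^bsub>?A\<^esub> x)"
    using V.R.is_cring x(1)[unfolded tensor_free_def]
  proof (induction rule: free_module_induct)
    case zero
    then show ?case
      using P0 linear_map_zero[OF A.module_axioms module_tensor[OF V W] proj]
      by (simp flip: tensor_free_def)
  next
    case (add c s x)
    note add = add[folded tensor_free_def]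
    obtain v w where s: "s = (v, w)" "v \<in> carrier V" "w \<in> carrier W" using add by auto
    note e = tensor_free_basis_closed[OF V s(2,3)]
    have "?N +>\<^bsub>?A\<^esub> (c \<odot>\<^bsub>?A\<^esub> free_basis K s) = c \<odot>\<^bsub>tensor K V W\<^esub> pure_tensor K V W v w"
      unfolding s(1) pure_tensor_def using linear_mapsD(3)[OF proj add(1) e] .
    also have "\<dots> = pure_tensor K V W (c \<odot>\<^bsub>V\<^esub> v) w"
      using bilinear_mapsD(4)[OF pure_tensor_bilinear[OF V W] add(1) s(2,3)] by simp
    finally have "?N +>\<^bsub>?A\<^esub> (c \<odot>\<^bsub>?A\<^esub> free_basis K s \<oplus>\<^bsub>?A\<^esub> x) =
        pure_tensor K V W (c \<odot>\<^bsub>V\<^esub> v) w \<oplus>\<^bsub>tensor K V W\<^esub> (?N +>\<^bsub>?A\<^esub> x)"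
      using linear_mapsD(2)[OF proj _ add(3), of "c \<odot>\<^bsub>?A\<^esub> free_basis K s"] add(1) e s(1) by simp
    moreover have "?N +>\<^bsub>?A\<^esub> x \<in> carrier (tensor K V W)"
      using linear_mapsD(1)[OF proj add(3)] .
    ultimately show ?case
      using assms(5)[of "c \<odot>\<^bsub>V\<^esub> v" w] add(1,4) s(2,3) by (simp flip: tensor_free_def)
  qed
  then show ?thesis using x(2) by simp
qed

text \<open>The uniqueness half of the universal property. Nearly all later identities between maps
  out of a tensor product are instances, with a computation on pure tensors as the only
  content.\<close>

lemma tensor_ext:
  assumes "module K V" "module K W" "module K U"
    and f: "f \<in> linear_maps K (tensor K V W) U" and g: "g \<in> linear_maps K (tensor K V W) U"
    and eq: "\<And>v w. \<lbrakk>v \<in> carrier V; w \<in> carrier W\<rbrakk> \<Longrightarrow>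
      f (pure_tensor K V W v w) = g (pure_tensor K V W v w)"
    and "t \<in> carrier (tensor K V W)"
  shows "f t = g t"
  using assms(1,2,7)
proof (induction rule: tensor_induct)
  case zero
  show ?case
    by (simp add: linear_map_zero[OF module_tensor[OF assms(1,2)] assms(3)] f g)
next
  case (add v w t)
  then show ?case
    using eq pure_tensor_closed[OF assms(1,2)]
    by (simp add: linear_mapsD[OF f] linear_mapsD[OF g])
qed

section \<open>Existence half of the universal property of the tensor product\<close>

context
  fixes K :: "('k, 'm) ring_scheme" and V :: "('k, 'v, 'p) module_scheme"
    and W :: "('k, 'w, 'q) module_scheme" and U :: "('k, 'u, 'r) module_scheme" and \<phi>
  assumes V: "module K V" and W: "module K W" and U: "module K U"
    and \<phi>: "\<phi> \<in> bilinear_maps K V W U"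
begin

interpretation V: module K V by (rule V)
interpretation W: module K W by (rule W)
interpretation U: module K U by (rule U)
interpretation A: module K "tensor_free K V W" by (rule module_tensor_free[OF V])

lemma free_lift_pair_linear:
  "free_lift K U (\<lambda>p. \<phi> (fst p) (snd p)) \<in> linear_maps K (tensor_free K V W) U"
  unfolding tensor_free_def
  by (rule free_lift_linear[OF U]) (auto simp: bilinear_mapsD(1)[OF \<phi>])

lemma free_lift_pair_basis:
  assumes "v \<in> carrier V" "w \<in> carrier W"
  shows "free_lift K U (\<lambda>p. \<phi> (fst p) (snd p)) (free_basis K (v, w)) = \<phi> v w"
  by (subst free_lift_basis[OF U, of _ "carrier V \<times> carrier W"])
    (use assms in \<open>auto simp: bilinear_mapsD(1)[OF \<phi>]\<close>)

text \<open>On each defining relation, bilinearity of \<open>\<phi>\<close> makes the value a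
  difference of two equal vectors; a linear map that kills the generators kills the submodule
  generated by them.\<close>

lemma free_lift_tensor_kernel:
  assumes "n \<in> tensor_kernel K V W"
  shows "free_lift K U (\<lambda>p. \<phi> (fst p) (snd p)) n = \<zero>\<^bsub>U\<^esub>"
proof (rule linear_map_generated_zero[OF A.module_axioms U free_lift_pair_linear tensor_relations_closed[OF V W]])
  note e = tensor_free_basis_closed[OF V]
  have minus_self: "u \<ominus>\<^bsub>U\<^esub> u = \<zero>\<^bsub>U\<^esub>" if "u \<in> carrier U" for u
    using that by (simp add: a_minus_def U.M.r_neg)
  fix x assume "x \<in> tensor_relations K V W"
  then show "free_lift K U (\<lambda>p. \<phi> (fst p) (snd p)) x = \<zero>\<^bsub>U\<^esub>"
    by (elim tensor_relationsE) (simp_all add: linear_map_minus[OF A.module_axioms U free_lift_pair_linear] e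
      linear_mapsD[OF free_lift_pair_linear] free_lift_pair_basis bilinear_mapsD[OF \<phi>] minus_self)
qed (use assms tensor_kernel_def in metis)

text \<open>The definite description denotes: \<open>x\<close> lies in its own coset, and the linear
  extension is constant there since it vanishes on the kernel. Afterwards the lift can be computed
  from any representative.\<close>

lemma tensor_lift_coset:
  assumes "x \<in> carrier (tensor_free K V W)"
  shows "tensor_lift K V W U \<phi> (tensor_kernel K V W +>\<^bsub>tensor_free K V W\<^esub> x) =
    free_lift K U (\<lambda>p. \<phi> (fst p) (snd p)) x" (is "_ = ?L x")
proof -
  note N = submodule_tensor_kernel[OF V W]
  have "\<zero>\<^bsub>tensor_free K V W\<^esub> \<in> tensor_kernel K V W"
    using subgroup.one_closed[OF submodule.axioms(1)[OF N]] by simp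
  then have x: "x \<in> tensor_kernel K V W +>\<^bsub>tensor_free K V W\<^esub> x"
    using A.M.l_zero[OF assms] unfolding a_r_coset_def' by force
  show ?thesis
    unfolding tensor_lift_def free_lift_def[symmetric]
  proof (rule the_equality)
    show "\<exists>y\<in>tensor_kernel K V W +>\<^bsub>tensor_free K V W\<^esub> x. ?L x = ?L y" using x by blast
  next
    fix u assume "\<exists>y\<in>tensor_kernel K V W +>\<^bsub>tensor_free K V W\<^esub> x. u = ?L y"
    then show "u = ?L x"
      using linear_map_coset[OF A.module_axioms N U free_lift_pair_linear free_lift_tensor_kernel assms] by blast
  qed
qed

lemma tensor_lift_linear: "tensor_lift K V W U \<phi> \<in> linear_maps K (tensor K V W) U"
proof -
  note N = submodule_tensor_kernel[OF V W]
  note q = quotient_module_add[OF A.module_axioms N] quotient_module_smult[OF A.module_axioms N]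
    quotient_module_carrier[OF A.module_axioms N]
  show ?thesis unfolding tensor_def
    by (rule linear_mapsI)
      (auto simp: q tensor_lift_coset linear_mapsD[OF free_lift_pair_linear])
qed

lemma tensor_lift_pure:
  assumes "v \<in> carrier V" "w \<in> carrier W"
  shows "tensor_lift K V W U \<phi> (pure_tensor K V W v w) = \<phi> v w"
  unfolding pure_tensor_def
  by (simp add: tensor_lift_coset tensor_free_basis_closed[OF V] assms free_lift_pair_basis)

end

section \<open>Maps between tensor products\<close>

text \<open>Nested lifts, as in \<open>tensor_assoc\<close> and \<open>tensor_interchange\<close>,
  must be linear also in the variables that the inner lift treats as constants. For each law in
  \<open>a\<close>, both sides are linear in \<open>t\<close> and agree on pure tensors by
  \<open>lin\<close>.\<close>

lemma tensor_lift_linear_param: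
  assumes A: "module K A" and V: "module K V" and W: "module K W" and U: "module K U"
    and \<psi>: "\<And>a. a \<in> carrier A \<Longrightarrow> \<psi> a \<in> bilinear_maps K V W U"
    and lin: "\<And>v w. \<lbrakk>v \<in> carrier V; w \<in> carrier W\<rbrakk> \<Longrightarrow> (\<lambda>a. \<psi> a v w) \<in> linear_maps K A U"
    and t: "t \<in> carrier (tensor K V W)"
  shows "(\<lambda>a. tensor_lift K V W U (\<psi> a) t) \<in> linear_maps K A U"
proof -
  interpret A: module K A by fact
  note L = tensor_lift_linear[OF V W U \<psi>] and P = tensor_lift_pure[OF V W U \<psi>]
  show ?thesis
  proof (rule linear_mapsI)
    fix a assume a: "a \<in> carrier A"
    show "tensor_lift K V W U (\<psi> a) t \<in> carrier U" by (rule linear_mapsD(1)[OF L[OF a] t])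
    fix b assume b: "b \<in> carrier A"
    show "tensor_lift K V W U (\<psi> (a \<oplus>\<^bsub>A\<^esub> b)) t =
        tensor_lift K V W U (\<psi> a) t \<oplus>\<^bsub>U\<^esub> tensor_lift K V W U (\<psi> b) t"
      by (rule tensor_ext[OF V W U L linear_map_add[OF U L L] _ t])
        (use a b in \<open>auto simp: P linear_mapsD(2)[OF lin]\<close>)
  next
    fix c a assume ca: "c \<in> carrier K" "a \<in> carrier A"
    show "tensor_lift K V W U (\<psi> (c \<odot>\<^bsub>A\<^esub> a)) t = c \<odot>\<^bsub>U\<^esub> tensor_lift K V W U (\<psi> a) t"
      by (rule tensor_ext[OF V W U L linear_map_smult[OF U L] _ t])
        (use ca in \<open>auto simp: P linear_mapsD(3)[OF lin]\<close>)
  qed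
qed

lemma bilinear_maps_iff:
  "\<phi> \<in> bilinear_maps K V W U \<longleftrightarrow> (\<forall>v\<in>carrier V. \<phi> v \<in> linear_maps K W U) \<and>
    (\<forall>w\<in>carrier W. (\<lambda>v. \<phi> v w) \<in> linear_maps K V U)"
  by (simp add: bilinear_maps_def)

context
  fixes K :: "('k, 'm) ring_scheme" and V :: "('k, 'v, 'p) module_scheme"
    and W :: "('k, 'w, 'q) module_scheme"
    and P :: "('k, 'x, 'r) module_scheme" and Q :: "('k, 'y, 's) module_scheme" and f g
  assumes V: "module K V" and W: "module K W" and P: "module K P" and Q: "module K Q"
    and f: "f \<in> linear_maps K V P" and g: "g \<in> linear_maps K W Q"
begin

lemma pure_tensor_comp_bilinear:
  "(\<lambda>v w. pure_tensor K P Q (f v) (g w)) \<in> bilinear_maps K V W (tensor K P Q)"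
  by (rule bilinear_maps_comp[OF pure_tensor_bilinear[OF P Q] f g linear_map_id])

lemma tensor_map_linear: "tensor_map K V W P Q f g \<in> linear_maps K (tensor K V W) (tensor K P Q)"
  unfolding tensor_map_def
  by (rule tensor_lift_linear[OF V W module_tensor[OF P Q] pure_tensor_comp_bilinear])

lemma tensor_map_pure:
  assumes "v \<in> carrier V" "w \<in> carrier W"
  shows "tensor_map K V W P Q f g (pure_tensor K V W v w) = pure_tensor K P Q (f v) (g w)"
  unfolding tensor_map_def
  by (rule tensor_lift_pure[OF V W module_tensor[OF P Q] pure_tensor_comp_bilinear assms])

lemma tensor_map_comp:
  fixes P' :: "('k, 'x1, 'r1) module_scheme" and Q' :: "('k, 'y1, 's1) module_scheme"
  assumes P': "module K P'" and Q': "module K Q'"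
    and f': "f' \<in> linear_maps K P P'" and g': "g' \<in> linear_maps K Q Q'"
    and t: "t \<in> carrier (tensor K V W)"
  shows "tensor_map K P Q P' Q' f' g' (tensor_map K V W P Q f g t) =
    tensor_map K V W P' Q' (\<lambda>v. f' (f v)) (\<lambda>w. g' (g w)) t"
proof -
  \<comment> \<open>The facts of this context are tied to the fixed maps \<open>f\<close> and
    \<open>g\<close>, so linearity of the other two tensor maps is derived from the universal
    property again.\<close>
  have 1: "tensor_map K P Q P' Q' f' g' \<in> linear_maps K (tensor K P Q) (tensor K P' Q')"
    unfolding tensor_map_def
    by (intro tensor_lift_linear P Q module_tensor P' Q'
      bilinear_maps_comp[OF pure_tensor_bilinear[OF P' Q'] f' g' linear_map_id])
  have b: "(\<lambda>v w. pure_tensor K P' Q' (f' (f v)) (g' (g w))) \<in> bilinear_maps K V W (tensor K P' Q')"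
    by (intro bilinear_maps_comp[OF pure_tensor_bilinear[OF P' Q'] _ _ linear_map_id]
      linear_map_comp[OF f f'] linear_map_comp[OF g g'])
  have 2: "tensor_map K V W P' Q' (\<lambda>v. f' (f v)) (\<lambda>w. g' (g w)) \<in> linear_maps K (tensor K V W) (tensor K P' Q')"
    unfolding tensor_map_def by (intro tensor_lift_linear V W module_tensor P' Q' b)
  show ?thesis
  proof (rule tensor_ext[OF V W module_tensor[OF P' Q'] linear_map_comp[OF tensor_map_linear 1] 2 _ t])
    fix v w assume vw: "v \<in> carrier V" "w \<in> carrier W"
    have "tensor_map K P Q P' Q' f' g' (pure_tensor K P Q (f v) (g w)) =
        pure_tensor K P' Q' (f' (f v)) (g' (g w))"
      unfolding tensor_map_def
      by (intro tensor_lift_pure P Q module_tensor P' Q'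
        bilinear_maps_comp[OF pure_tensor_bilinear[OF P' Q'] f' g' linear_map_id]
        linear_mapsD(1)[OF f] linear_mapsD(1)[OF g] vw)
    also have "\<dots> = tensor_map K V W P' Q' (\<lambda>v. f' (f v)) (\<lambda>w. g' (g w)) (pure_tensor K V W v w)"
      unfolding tensor_map_def by (intro tensor_lift_pure[symmetric] V W module_tensor P' Q' b vw)
    finally show "tensor_map K P Q P' Q' f' g' (tensor_map K V W P Q f g (pure_tensor K V W v w)) =
      tensor_map K V W P' Q' (\<lambda>v. f' (f v)) (\<lambda>w. g' (g w)) (pure_tensor K V W v w)"
      by (simp add: tensor_map_pure[OF vw])
  qed
qed

end

text \<open>Agreement with the identity is asked on the carriers only: a retraction is the identity
  on \<open>C\<close> but not on the rest of \<open>B\<close>.\<close>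

lemma tensor_map_ident:
  assumes V: "module K V" and W: "module K W"
    and f: "f \<in> linear_maps K V V" and g: "g \<in> linear_maps K W W"
    and "\<And>v. v \<in> carrier V \<Longrightarrow> f v = v" "\<And>w. w \<in> carrier W \<Longrightarrow> g w = w"
    and t: "t \<in> carrier (tensor K V W)"
  shows "tensor_map K V W V W f g t = t"
  by (rule tensor_ext[OF V W module_tensor[OF V W] tensor_map_linear[OF V W V W f g] linear_map_id _ t])
    (simp add: tensor_map_pure[OF V W V W f g] assms(5,6))

text \<open>Functoriality carries left inverses of the factors to a left inverse of the tensor map.
  This is how retractions make the tensored inclusions injective.\<close>

lemma tensor_map_left_inverse:
  assumes V: "module K V" and W: "module K W" and P: "module K P" and Q: "module K Q"
    and f: "f \<in> linear_maps K V P" and g: "g \<in> linear_maps K W Q"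
    and f': "f' \<in> linear_maps K P V" and g': "g' \<in> linear_maps K Q W"
    and "\<And>v. v \<in> carrier V \<Longrightarrow> f' (f v) = v" "\<And>w. w \<in> carrier W \<Longrightarrow> g' (g w) = w"
    and t: "t \<in> carrier (tensor K V W)"
  shows "tensor_map K P Q V W f' g' (tensor_map K V W P Q f g t) = t"
  unfolding tensor_map_comp[OF V W P Q f g V W f' g' t]
  by (rule tensor_map_ident[OF V W linear_map_comp[OF f f'] linear_map_comp[OF g g'] assms(9,10) t])

section \<open>The associativity map on pure tensors\<close>

context
  fixes K :: "('k, 'm) ring_scheme" and U :: "('k, 'u, 'p) module_scheme"
    and V :: "('k, 'v, 'q) module_scheme" and W :: "('k, 'w, 'r) module_scheme"
  assumes U: "module K U" and V: "module K V" and W: "module K W"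
begin

lemma tensor_assoc_inner_bilinear:
  assumes "w \<in> carrier W"
  shows "(\<lambda>u v. pure_tensor K U (tensor K V W) u (pure_tensor K V W v w))
    \<in> bilinear_maps K U V (tensor K U (tensor K V W))"
  by (rule bilinear_maps_comp[OF pure_tensor_bilinear[OF U module_tensor[OF V W]] linear_map_id
    bilinear_mapsD(7)[OF pure_tensor_bilinear[OF V W] assms] linear_map_id])

text \<open>In \<open>s\<close> the map is a lift and hence linear; in \<open>w\<close> it is a lift
  depending on a parameter, covered by \<open>tensor_lift_linear_param\<close>.\<close>

lemma tensor_assoc_bilinear:
  defines "T \<equiv> tensor K U (tensor K V W)"
  shows "(\<lambda>s w. tensor_lift K U V T (\<lambda>u v. pure_tensor K U (tensor K V W) u (pure_tensor K V W v w)) s)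
    \<in> bilinear_maps K (tensor K U V) W T"
  unfolding bilinear_maps_iff T_def
proof (intro conjI ballI)
  fix s assume "s \<in> carrier (tensor K U V)"
  then show "(\<lambda>w. tensor_lift K U V (tensor K U (tensor K V W))
      (\<lambda>u v. pure_tensor K U (tensor K V W) u (pure_tensor K V W v w)) s)
      \<in> linear_maps K W (tensor K U (tensor K V W))"
    by (intro tensor_lift_linear_param W U V module_tensor tensor_assoc_inner_bilinear
      linear_map_comp[OF bilinear_mapsD(6)[OF pure_tensor_bilinear[OF V W]]
        bilinear_mapsD(6)[OF pure_tensor_bilinear[OF U module_tensor[OF V W]]]])
next
  fix w assume "w \<in> carrier W"
  then show "(\<lambda>s. tensor_lift K U V (tensor K U (tensor K V W))
      (\<lambda>u v. pure_tensor K U (tensor K V W) u (pure_tensor K V W v w)) s)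
      \<in> linear_maps K (tensor K U V) (tensor K U (tensor K V W))"
    by (intro tensor_lift_linear U V W module_tensor tensor_assoc_inner_bilinear)
qed

lemma tensor_assoc_linear:
  "tensor_assoc K U V W \<in> linear_maps K (tensor K (tensor K U V) W) (tensor K U (tensor K V W))"
  unfolding tensor_assoc_def Let_def
  by (intro tensor_lift_linear module_tensor U V W tensor_assoc_bilinear)

lemma tensor_assoc_pure:
  assumes "u \<in> carrier U" "v \<in> carrier V" "w \<in> carrier W"
  shows "tensor_assoc K U V W (pure_tensor K (tensor K U V) W (pure_tensor K U V u v) w) =
    pure_tensor K U (tensor K V W) u (pure_tensor K V W v w)"
proof -
  have "tensor_assoc K U V W (pure_tensor K (tensor K U V) W (pure_tensor K U V u v) w) =
      tensor_lift K U V (tensor K U (tensor K V W))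
        (\<lambda>u v. pure_tensor K U (tensor K V W) u (pure_tensor K V W v w)) (pure_tensor K U V u v)"
    unfolding tensor_assoc_def Let_def
    by (intro tensor_lift_pure[where \<phi> = "\<lambda>s w. tensor_lift K U V (tensor K U (tensor K V W))
        (\<lambda>u v. pure_tensor K U (tensor K V W) u (pure_tensor K V W v w)) s"]
      module_tensor U V W tensor_assoc_bilinear pure_tensor_closed assms)
  also have "\<dots> = pure_tensor K U (tensor K V W) u (pure_tensor K V W v w)"
    by (intro tensor_lift_pure module_tensor U V W tensor_assoc_inner_bilinear assms)
  finally show ?thesis .
qed

end

section \<open>The interchange map on pure tensors\<close>

context
  fixes K :: "('k, 'm) ring_scheme" and U :: "('k, 'u, 'p) module_scheme"
    and V :: "('k, 'v, 'q) module_scheme" and P :: "('k, 'x, 'r) module_scheme"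
    and Q :: "('k, 'y, 's) module_scheme"
  assumes U: "module K U" and V: "module K V" and P: "module K P" and Q: "module K Q"
begin

private abbreviation (input) "T \<equiv> tensor K (tensor K U P) (tensor K V Q)"
private abbreviation (input) "\<phi> u v x y \<equiv> pure_tensor K (tensor K U P) (tensor K V Q)
  (pure_tensor K U P u x) (pure_tensor K V Q v y)"

private lemmas pure = pure_tensor_bilinear[OF module_tensor[OF U P] module_tensor[OF V Q]]

lemma module_interchange_target: "module K T"
  by (intro module_tensor U V P Q)

lemma interchange_bilinear_inner:
  assumes "u \<in> carrier U" "v \<in> carrier V"
  shows "(\<lambda>x y. \<phi> u v x y) \<in> bilinear_maps K P Q T"
  by (intro bilinear_maps_comp[OF pure _ _ linear_map_id]
    bilinear_mapsD(6)[OF pure_tensor_bilinear[OF U P] assms(1)]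
    bilinear_mapsD(6)[OF pure_tensor_bilinear[OF V Q] assms(2)])

text \<open>Here \<open>t\<close> is fixed and \<open>u\<close>, \<open>v\<close> are parameters of
  the innermost lift. Dependence on either one is a composite of two pure tensor maps, each linear
  in one slot.\<close>

lemma interchange_bilinear_middle:
  assumes t: "t \<in> carrier (tensor K P Q)"
  shows "(\<lambda>u v. tensor_lift K P Q T (\<lambda>x y. \<phi> u v x y) t) \<in> bilinear_maps K U V T"
  unfolding bilinear_maps_iff
proof (intro conjI ballI)
  fix u assume u: "u \<in> carrier U"
  show "(\<lambda>v. tensor_lift K P Q T (\<lambda>x y. \<phi> u v x y) t) \<in> linear_maps K V T"
    by (intro tensor_lift_linear_param[OF V P Q module_interchange_target _ _ t]
      interchange_bilinear_inner u
      linear_map_comp[OF bilinear_mapsD(7)[OF pure_tensor_bilinear[OF V Q]] bilinear_mapsD(6)[OF pure]]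
      pure_tensor_closed U P)
next
  fix v assume v: "v \<in> carrier V"
  show "(\<lambda>u. tensor_lift K P Q T (\<lambda>x y. \<phi> u v x y) t) \<in> linear_maps K U T"
    by (intro tensor_lift_linear_param[OF U P Q module_interchange_target _ _ t]
      interchange_bilinear_inner v
      linear_map_comp[OF bilinear_mapsD(7)[OF pure_tensor_bilinear[OF U P]] bilinear_mapsD(7)[OF pure]]
      pure_tensor_closed V Q)
qed

lemma interchange_bilinear:
  "(\<lambda>s t. tensor_lift K U V T (\<lambda>u v. tensor_lift K P Q T (\<lambda>x y. \<phi> u v x y) t) s)
    \<in> bilinear_maps K (tensor K U V) (tensor K P Q) T"
  unfolding bilinear_maps_iff
proof (intro conjI ballI)
  fix s assume s: "s \<in> carrier (tensor K U V)"
  show "(\<lambda>t. tensor_lift K U V T (\<lambda>u v. tensor_lift K P Q T (\<lambda>x y. \<phi> u v x y) t) s)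
      \<in> linear_maps K (tensor K P Q) T"
    by (intro tensor_lift_linear_param[OF module_tensor[OF P Q] U V module_interchange_target _ _ s]
      interchange_bilinear_middle tensor_lift_linear[OF P Q module_interchange_target]
      interchange_bilinear_inner)
next
  fix t assume t: "t \<in> carrier (tensor K P Q)"
  show "(\<lambda>s. tensor_lift K U V T (\<lambda>u v. tensor_lift K P Q T (\<lambda>x y. \<phi> u v x y) t) s)
      \<in> linear_maps K (tensor K U V) T"
    by (intro tensor_lift_linear[OF U V module_interchange_target] interchange_bilinear_middle t)
qed

lemma tensor_interchange_linear:
  "tensor_interchange K U V P Q \<in> linear_maps K (tensor K (tensor K U V) (tensor K P Q)) T"
  unfolding tensor_interchange_def Let_def
  by (intro tensor_lift_linear module_tensor U V P Q interchange_bilinear)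

lemma tensor_interchange_pure:
  assumes "u \<in> carrier U" "v \<in> carrier V" "x \<in> carrier P" "y \<in> carrier Q"
  shows "tensor_interchange K U V P Q (pure_tensor K (tensor K U V) (tensor K P Q)
      (pure_tensor K U V u v) (pure_tensor K P Q x y)) = \<phi> u v x y"
proof -
  have "tensor_interchange K U V P Q (pure_tensor K (tensor K U V) (tensor K P Q)
      (pure_tensor K U V u v) (pure_tensor K P Q x y)) =
    tensor_lift K U V T (\<lambda>u v. tensor_lift K P Q T (\<lambda>x y. \<phi> u v x y) (pure_tensor K P Q x y))
      (pure_tensor K U V u v)"
    unfolding tensor_interchange_def Let_def
    by (rule tensor_lift_pure[OF module_tensor[OF U V] module_tensor[OF P Q]
      module_interchange_target interchange_bilinear]) (intro pure_tensor_closed U V P Q assms)+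
  also have "\<dots> = tensor_lift K P Q T (\<lambda>x y. \<phi> u v x y) (pure_tensor K P Q x y)"
    by (rule tensor_lift_pure[OF U V module_interchange_target interchange_bilinear_middle])
      (intro pure_tensor_closed P Q assms)+
  also have "\<dots> = \<phi> u v x y"
    by (rule tensor_lift_pure[OF P Q module_interchange_target interchange_bilinear_inner]) (fact assms)+
  finally show ?thesis .
qed

end

text \<open>Post-composition of a lift with a linear map. It serves to change the target, for
  instance from a subspace to \<open>B\<close>.\<close>

lemma linear_map_tensor_lift:
  assumes V: "module K V" and W: "module K W" and U: "module K U" and U': "module K U'"
    and \<phi>: "\<phi> \<in> bilinear_maps K V W U" and h: "h \<in> linear_maps K U U'"
    and \<psi>: "\<psi> \<in> bilinear_maps K V W U'"
    and eq: "\<And>v w. \<lbrakk>v \<in> carrier V; w \<in> carrier W\<rbrakk> \<Longrightarrow> h (\<phi> v w) = \<psi> v w"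
    and t: "t \<in> carrier (tensor K V W)"
  shows "h (tensor_lift K V W U \<phi> t) = tensor_lift K V W U' \<psi> t"
  by (rule tensor_ext[OF V W U' linear_map_comp[OF tensor_lift_linear[OF V W U \<phi>] h]
    tensor_lift_linear[OF V W U' \<psi>] _ t])
    (simp add: tensor_lift_pure[OF V W U \<phi>] tensor_lift_pure[OF V W U' \<psi>] eq)

text \<open>Pre-composition of a lift with a tensor map. It serves to change the source, for
  instance from a subspace to \<open>B\<close>.\<close>

lemma tensor_lift_tensor_map:
  assumes V: "module K V" and W: "module K W" and P: "module K P" and Q: "module K Q"
    and U: "module K U" and f: "f \<in> linear_maps K V P" and g: "g \<in> linear_maps K W Q"
    and \<phi>: "\<phi> \<in> bilinear_maps K P Q U" and \<psi>: "\<psi> \<in> bilinear_maps K V W U"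
    and eq: "\<And>v w. \<lbrakk>v \<in> carrier V; w \<in> carrier W\<rbrakk> \<Longrightarrow> \<phi> (f v) (g w) = \<psi> v w"
    and t: "t \<in> carrier (tensor K V W)"
  shows "tensor_lift K P Q U \<phi> (tensor_map K V W P Q f g t) = tensor_lift K V W U \<psi> t"
  by (rule tensor_ext[OF V W U linear_map_comp[OF tensor_map_linear[OF V W P Q f g]
    tensor_lift_linear[OF P Q U \<phi>]] tensor_lift_linear[OF V W U \<psi>] _ t])
    (simp add: tensor_map_pure[OF V W P Q f g] tensor_lift_pure[OF P Q U \<phi>]
      tensor_lift_pure[OF V W U \<psi>] eq linear_mapsD(1)[OF f] linear_mapsD(1)[OF g])

text \<open>The maps need to agree only on the carriers. This matters for the two ways around the
  square for the comultiplication, which are known to agree on \<open>C\<close> only.\<close>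

lemma tensor_map_cong:
  assumes V: "module K V" and W: "module K W" and P: "module K P" and Q: "module K Q"
    and f: "f \<in> linear_maps K V P" and g: "g \<in> linear_maps K W Q"
    and f': "f' \<in> linear_maps K V P" and g': "g' \<in> linear_maps K W Q"
    and eq: "\<And>v. v \<in> carrier V \<Longrightarrow> f v = f' v" "\<And>w. w \<in> carrier W \<Longrightarrow> g w = g' w"
    and t: "t \<in> carrier (tensor K V W)"
  shows "tensor_map K V W P Q f g t = tensor_map K V W P Q f' g' t"
  by (rule tensor_ext[OF V W module_tensor[OF P Q] tensor_map_linear[OF V W P Q f g]
    tensor_map_linear[OF V W P Q f' g'] _ t])
    (simp add: tensor_map_pure[OF V W P Q f g] tensor_map_pure[OF V W P Q f' g'] eq)

text \<open>For fixed \<open>w\<close>, forming the pure tensor with \<open>w\<close> is linear in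
  \<open>s\<close>, so a second use of \<open>tensor_ext\<close> splits \<open>s\<close> into pure
  tensors as well.\<close>

lemma tensor_ext_left:
  assumes U: "module K U" and V: "module K V" and W: "module K W" and M: "module K M"
    and f: "f \<in> linear_maps K (tensor K (tensor K U V) W) M"
    and g: "g \<in> linear_maps K (tensor K (tensor K U V) W) M"
    and eq: "\<And>u v w. \<lbrakk>u \<in> carrier U; v \<in> carrier V; w \<in> carrier W\<rbrakk> \<Longrightarrow>
      f (pure_tensor K (tensor K U V) W (pure_tensor K U V u v) w) =
      g (pure_tensor K (tensor K U V) W (pure_tensor K U V u v) w)"
    and t: "t \<in> carrier (tensor K (tensor K U V) W)"
  shows "f t = g t"
proof (rule tensor_ext[OF module_tensor[OF U V] W M f g _ t])
  fix s w assume s: "s \<in> carrier (tensor K U V)" and w: "w \<in> carrier W"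
  note l = bilinear_mapsD(7)[OF pure_tensor_bilinear[OF module_tensor[OF U V] W] w]
  show "f (pure_tensor K (tensor K U V) W s w) = g (pure_tensor K (tensor K U V) W s w)"
    by (rule tensor_ext[OF U V M linear_map_comp[OF l f] linear_map_comp[OF l g] _ s]) (simp add: eq w)
qed

lemma tensor_ext_both:
  assumes U: "module K U" and V: "module K V" and P: "module K P" and Q: "module K Q"
    and M: "module K M"
    and f: "f \<in> linear_maps K (tensor K (tensor K U V) (tensor K P Q)) M"
    and g: "g \<in> linear_maps K (tensor K (tensor K U V) (tensor K P Q)) M"
    and eq: "\<And>u v x y. \<lbrakk>u \<in> carrier U; v \<in> carrier V; x \<in> carrier P; y \<in> carrier Q\<rbrakk> \<Longrightarrow>
      f (pure_tensor K (tensor K U V) (tensor K P Q) (pure_tensor K U V u v) (pure_tensor K P Q x y)) =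
      g (pure_tensor K (tensor K U V) (tensor K P Q) (pure_tensor K U V u v) (pure_tensor K P Q x y))"
    and t: "t \<in> carrier (tensor K (tensor K U V) (tensor K P Q))"
  shows "f t = g t"
proof (rule tensor_ext_left[OF U V module_tensor[OF P Q] M f g _ t])
  fix u v s assume uv: "u \<in> carrier U" "v \<in> carrier V" and s: "s \<in> carrier (tensor K P Q)"
  note l = bilinear_mapsD(6)[OF pure_tensor_bilinear[OF module_tensor[OF U V] module_tensor[OF P Q]]
    pure_tensor_closed[OF U V uv]]
  show "f (pure_tensor K (tensor K U V) (tensor K P Q) (pure_tensor K U V u v) s) =
      g (pure_tensor K (tensor K U V) (tensor K P Q) (pure_tensor K U V u v) s)"
    by (rule tensor_ext[OF P Q M linear_map_comp[OF l f] linear_map_comp[OF l g] _ s]) (simp add: eq uv)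
qed

text \<open>Both sides send a triple of vectors to the pure tensor of its images under
  \<open>f\<close>, \<open>g\<close>, \<open>h\<close>. Applied to inclusions, this carries the
  inclusion of a triple tensor product past the rebracketing.\<close>

lemma tensor_assoc_natural:
  assumes U: "module K U" and V: "module K V" and W: "module K W"
    and U': "module K U'" and V': "module K V'" and W': "module K W'"
    and f: "f \<in> linear_maps K U U'" and g: "g \<in> linear_maps K V V'" and h: "h \<in> linear_maps K W W'"
    and t: "t \<in> carrier (tensor K (tensor K U V) W)"
  shows "tensor_map K U (tensor K V W) U' (tensor K V' W') f (tensor_map K V W V' W' g h)
      (tensor_assoc K U V W t) =
    tensor_assoc K U' V' W'
      (tensor_map K (tensor K U V) W (tensor K U' V') W' (tensor_map K U V U' V' f g) h t)"
proof (rule tensor_ext_left[OF U V W module_tensor[OF U' module_tensor[OF V' W']] _ _ _ t])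
  note fg = tensor_map_linear[OF U V U' V' f g] and gh = tensor_map_linear[OF V W V' W' g h]
  note l = linear_mapsD(1)[OF f] linear_mapsD(1)[OF g] linear_mapsD(1)[OF h]
  note m = tensor_map_linear[OF U module_tensor[OF V W] U' module_tensor[OF V' W'] f gh]
    tensor_map_linear[OF module_tensor[OF U V] W module_tensor[OF U' V'] W' fg h]
  show "(\<lambda>t. tensor_map K U (tensor K V W) U' (tensor K V' W') f (tensor_map K V W V' W' g h)
      (tensor_assoc K U V W t)) \<in> linear_maps K (tensor K (tensor K U V) W) (tensor K U' (tensor K V' W'))"
    by (rule linear_map_comp[OF tensor_assoc_linear[OF U V W] m(1)])
  show "(\<lambda>t. tensor_assoc K U' V' W'
      (tensor_map K (tensor K U V) W (tensor K U' V') W' (tensor_map K U V U' V' f g) h t))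
      \<in> linear_maps K (tensor K (tensor K U V) W) (tensor K U' (tensor K V' W'))"
    by (rule linear_map_comp[OF m(2) tensor_assoc_linear[OF U' V' W']])
  fix u v w assume uvw: "u \<in> carrier U" "v \<in> carrier V" "w \<in> carrier W"
  then show "tensor_map K U (tensor K V W) U' (tensor K V' W') f (tensor_map K V W V' W' g h)
      (tensor_assoc K U V W (pure_tensor K (tensor K U V) W (pure_tensor K U V u v) w)) =
    tensor_assoc K U' V' W'
      (tensor_map K (tensor K U V) W (tensor K U' V') W' (tensor_map K U V U' V' f g) h
        (pure_tensor K (tensor K U V) W (pure_tensor K U V u v) w))"
    by (simp add: tensor_assoc_pure[OF U V W] tensor_assoc_pure[OF U' V' W'] l
      tensor_map_pure[OF U module_tensor[OF V W] U' module_tensor[OF V' W'] f gh]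
      tensor_map_pure[OF module_tensor[OF U V] W module_tensor[OF U' V'] W' fg h]
      tensor_map_pure[OF U V U' V' f g] tensor_map_pure[OF V W V' W' g h]
      pure_tensor_closed[OF U V] pure_tensor_closed[OF V W])
qed

section \<open>Retractions onto subspaces\<close>

text \<open>Suppose \<open>y = e + k x\<close> lies in \<open>C\<close>. If \<open>k\<close> is
  nonzero, dividing by it writes \<open>x\<close> as a sum of a vector of \<open>C\<close> and a
  vector of \<open>D\<close>, against the hypothesis; so \<open>k\<close> is zero and
  \<open>y\<close> lies in both \<open>C\<close> and \<open>D\<close>. The division is what requires
  a field.\<close>

lemma submodule_inter_trivial_extend:
  assumes "field K" "module K M" and C: "submodule C K M" and D: "submodule D K M"
    and CD: "C \<inter> D \<subseteq> {\<zero>\<^bsub>M\<^esub>}" and x: "x \<in> carrier M"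
    and nx: "\<not> (\<exists>c\<in>C. \<exists>d\<in>D. x = c \<oplus>\<^bsub>M\<^esub> d)"
  defines "D' \<equiv> {d \<oplus>\<^bsub>M\<^esub> k \<odot>\<^bsub>M\<^esub> x | d k. d \<in> D \<and> k \<in> carrier K}"
  shows "submodule D' K M" and "C \<inter> D' \<subseteq> {\<zero>\<^bsub>M\<^esub>}"
proof -
  interpret K: field K by fact
  interpret M: module K M by fact
  note c = M.submoduleE[OF C] and d = M.submoduleE[OF D]
  have cc: "y \<in> C \<Longrightarrow> y \<in> carrier M" and dc: "y \<in> D \<Longrightarrow> y \<in> carrier M" for y
    using c(1) d(1) by auto
  have zero: "\<zero>\<^bsub>M\<^esub> \<in> D" using subgroup.one_closed[OF submodule.axioms(1)[OF D]] by simp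
  show "submodule D' K M"
  proof (rule M.submoduleI)
    show "D' \<subseteq> carrier M" using dc x by (auto simp: D'_def)
    show "\<zero>\<^bsub>M\<^esub> \<in> D'"
      unfolding D'_def by (rule CollectI, rule exI[of _ "\<zero>\<^bsub>M\<^esub>"], rule exI[of _ "\<zero>\<^bsub>K\<^esub>"]) (use zero x in simp)
    fix a assume "a \<in> D'"
    then obtain e k where a: "a = e \<oplus>\<^bsub>M\<^esub> k \<odot>\<^bsub>M\<^esub> x" "e \<in> D" "k \<in> carrier K" by (auto simp: D'_def)
    have "\<ominus>\<^bsub>M\<^esub> a = (\<ominus>\<^bsub>M\<^esub> e) \<oplus>\<^bsub>M\<^esub> (\<ominus>\<^bsub>K\<^esub> k) \<odot>\<^bsub>M\<^esub> x"
      using a dc x by (simp add: M.smult_l_minus M.M.minus_add M.M.a_comm)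
    then show "\<ominus>\<^bsub>M\<^esub> a \<in> D'" using a d(3) by (auto simp: D'_def)
    { fix b assume "b \<in> D'"
      then obtain e' k' where b: "b = e' \<oplus>\<^bsub>M\<^esub> k' \<odot>\<^bsub>M\<^esub> x" "e' \<in> D" "k' \<in> carrier K"
        by (auto simp: D'_def)
      have "a \<oplus>\<^bsub>M\<^esub> b = (e \<oplus>\<^bsub>M\<^esub> e') \<oplus>\<^bsub>M\<^esub> (k \<oplus>\<^bsub>K\<^esub> k') \<odot>\<^bsub>M\<^esub> x"
        using a b dc x by (simp add: M.smult_l_distr M.M.a_ac)
      moreover have "e \<oplus>\<^bsub>M\<^esub> e' \<in> D" "k \<oplus>\<^bsub>K\<^esub> k' \<in> carrier K" using a b d(5) by auto
      ultimately show "a \<oplus>\<^bsub>M\<^esub> b \<in> D'" unfolding D'_def by blast }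
    { fix l assume l: "l \<in> carrier K"
      have "l \<odot>\<^bsub>M\<^esub> a = l \<odot>\<^bsub>M\<^esub> e \<oplus>\<^bsub>M\<^esub> (l \<otimes>\<^bsub>K\<^esub> k) \<odot>\<^bsub>M\<^esub> x"
        using a l dc x by (simp add: M.smult_r_distr M.smult_assoc1)
      moreover have "l \<odot>\<^bsub>M\<^esub> e \<in> D" "l \<otimes>\<^bsub>K\<^esub> k \<in> carrier K" using a l d(4) by auto
      ultimately show "l \<odot>\<^bsub>M\<^esub> a \<in> D'" unfolding D'_def by blast }
  qed
  show "C \<inter> D' \<subseteq> {\<zero>\<^bsub>M\<^esub>}"
  proof
    fix y assume y: "y \<in> C \<inter> D'"
    then obtain e k where a: "y = e \<oplus>\<^bsub>M\<^esub> k \<odot>\<^bsub>M\<^esub> x" "e \<in> D" "k \<in> carrier K" by (auto simp: D'_def)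
    show "y \<in> {\<zero>\<^bsub>M\<^esub>}"
    proof (cases "k = \<zero>\<^bsub>K\<^esub>")
      case True
      then have "y = e" using a x dc by simp
      then show ?thesis using y a CD by auto
    next
      case False
      then have k: "k \<in> Units K" using a(3) K.field_Units by auto
      then have ki: "inv\<^bsub>K\<^esub> k \<in> carrier K" by simp
      have "k \<odot>\<^bsub>M\<^esub> x = y \<oplus>\<^bsub>M\<^esub> (\<ominus>\<^bsub>M\<^esub> e)"
        using a dc x by (simp add: M.M.a_ac M.M.r_neg2 M.M.r_neg M.M.r_neg1)
      then have "inv\<^bsub>K\<^esub> k \<odot>\<^bsub>M\<^esub> (k \<odot>\<^bsub>M\<^esub> x) = inv\<^bsub>K\<^esub> k \<odot>\<^bsub>M\<^esub> y \<oplus>\<^bsub>M\<^esub> inv\<^bsub>K\<^esub> k \<odot>\<^bsub>M\<^esub> (\<ominus>\<^bsub>M\<^esub> e)"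
        using M.smult_r_distr[OF ki, of y "\<ominus>\<^bsub>M\<^esub> e"] y cc dc[OF a(2)] by simp
      moreover have "inv\<^bsub>K\<^esub> k \<odot>\<^bsub>M\<^esub> (k \<odot>\<^bsub>M\<^esub> x) = x"
        using k ki a(3) x by (simp flip: M.smult_assoc1)
      ultimately have "x = inv\<^bsub>K\<^esub> k \<odot>\<^bsub>M\<^esub> y \<oplus>\<^bsub>M\<^esub> inv\<^bsub>K\<^esub> k \<odot>\<^bsub>M\<^esub> (\<ominus>\<^bsub>M\<^esub> e)" by simp
      moreover have "inv\<^bsub>K\<^esub> k \<odot>\<^bsub>M\<^esub> y \<in> C" using ki y c(4) by auto
      moreover have "inv\<^bsub>K\<^esub> k \<odot>\<^bsub>M\<^esub> (\<ominus>\<^bsub>M\<^esub> e) \<in> D" using ki a(2) d(3,4) by auto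
      ultimately show ?thesis using nx by blast
    qed
  qed
qed

text \<open>Zorn's lemma yields a \<open>D\<close> maximal among the submodules that meet
  \<open>C\<close> trivially. A vector outside the sum of \<open>C\<close> and \<open>D\<close>
  could be adjoined to \<open>D\<close>, contradicting maximality.\<close>

lemma complement_exists:
  assumes "field K" "module K M" and C: "submodule C K M"
  obtains D where "submodule D K M" "C \<inter> D \<subseteq> {\<zero>\<^bsub>M\<^esub>}"
    "\<And>x. x \<in> carrier M \<Longrightarrow> \<exists>c\<in>C. \<exists>d\<in>D. x = c \<oplus>\<^bsub>M\<^esub> d"
proof -
  interpret K: field K by fact
  interpret M: module K M by fact
  let ?A = "{D. submodule D K M \<and> C \<inter> D \<subseteq> {\<zero>\<^bsub>M\<^esub>}}"
  have z: "\<zero>\<^bsub>M\<^esub> \<in> D" if "submodule D K M" for D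
    using subgroup.one_closed[OF submodule.axioms(1)[OF that]] by simp
  have "submodule {\<zero>\<^bsub>M\<^esub>} K M" by (rule M.submoduleI) auto
  then have ne: "?A \<noteq> {}" by blast
  have chain: "\<Union>\<C> \<in> ?A" if "\<C> \<noteq> {}" "subset.chain ?A \<C>" for \<C>
  proof -
    have sub: "submodule D K M" "C \<inter> D \<subseteq> {\<zero>\<^bsub>M\<^esub>}" if "D \<in> \<C>" for D
      using that \<open>subset.chain ?A \<C>\<close> by (auto simp: subset.chain_def)
    have lin: "D \<subseteq> E \<or> E \<subseteq> D" if "D \<in> \<C>" "E \<in> \<C>" for D E
      using that \<open>subset.chain ?A \<C>\<close> unfolding subset_chain_def by blast
    have "submodule (\<Union>\<C>) K M"
    proof (rule M.submoduleI)
      show "\<Union>\<C> \<subseteq> carrier M" using M.submoduleE(1)[OF sub(1)] by blast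
      show "\<zero>\<^bsub>M\<^esub> \<in> \<Union>\<C>" using \<open>\<C> \<noteq> {}\<close> z[OF sub(1)] by blast
      show "\<ominus>\<^bsub>M\<^esub> a \<in> \<Union>\<C>" if "a \<in> \<Union>\<C>" for a using that M.submoduleE(3)[OF sub(1)] by blast
      show "k \<odot>\<^bsub>M\<^esub> a \<in> \<Union>\<C>" if "k \<in> carrier K" "a \<in> \<Union>\<C>" for k a
        using that M.submoduleE(4)[OF sub(1)] by blast
      fix a b assume "a \<in> \<Union>\<C>" "b \<in> \<Union>\<C>"
      then obtain D E where "D \<in> \<C>" "E \<in> \<C>" "a \<in> D" "b \<in> E" by blast
      \<comment> \<open>The larger of the two members of the chain contains both summands.\<close>
      with lin[of D E] obtain F where "F \<in> \<C>" "a \<in> F" "b \<in> F" by blast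
      then show "a \<oplus>\<^bsub>M\<^esub> b \<in> \<Union>\<C>" using M.submoduleE(5)[OF sub(1)] by blast
    qed
    then show ?thesis using sub(2) by blast
  qed
  from subset_Zorn_nonempty[OF ne chain] obtain D where D: "D \<in> ?A"
    and max: "\<forall>E\<in>?A. D \<subseteq> E \<longrightarrow> E = D" by (rule bexE)
  show thesis
  proof (rule that[of D])
    show Ds: "submodule D K M" "C \<inter> D \<subseteq> {\<zero>\<^bsub>M\<^esub>}" using D by auto
    fix x assume x: "x \<in> carrier M"
    show "\<exists>c\<in>C. \<exists>d\<in>D. x = c \<oplus>\<^bsub>M\<^esub> d"
    proof (rule ccontr)
      assume nx: "\<not> ?thesis"
      let ?D = "{d \<oplus>\<^bsub>M\<^esub> k \<odot>\<^bsub>M\<^esub> x | d k. d \<in> D \<and> k \<in> carrier K}"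
      have dc: "d \<in> D \<Longrightarrow> d \<in> carrier M" for d using M.submoduleE(1)[OF Ds(1)] by auto
      have "D \<subseteq> ?D"
      proof
        fix d assume d: "d \<in> D"
        show "d \<in> ?D"
          by (rule CollectI, rule exI[of _ d], rule exI[of _ "\<zero>\<^bsub>K\<^esub>"]) (use d dc x in simp)
      qed
      with submodule_inter_trivial_extend[OF assms(1,2) C Ds x nx] have "?D = D"
        by (intro max[rule_format]) auto
      \<comment> \<open>Maximality has collapsed the enlarged submodule to \<open>D\<close>, so
        \<open>x\<close> itself lies in \<open>D\<close>, and \<open>0 + x\<close> is a splitting
        that was assumed not to exist.\<close>
      moreover have "x \<in> ?D"
        by (rule CollectI, rule exI[of _ "\<zero>\<^bsub>M\<^esub>"], rule exI[of _ "\<one>\<^bsub>K\<^esub>"])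
          (use z[OF Ds(1)] x in simp)
      ultimately have "x \<in> D" by simp
      moreover have "x = \<zero>\<^bsub>M\<^esub> \<oplus>\<^bsub>M\<^esub> x" using x by simp
      ultimately show False using nx z[OF C] by blast
    qed
  qed
qed

text \<open>The retraction is the projection onto \<open>C\<close> along a complement.\<close>

lemma linear_retraction:
  assumes "field K" "module K M" and C: "submodule C K M"
  obtains r where "r \<in> linear_maps K M (M\<lparr>carrier := C\<rparr>)" "\<And>c. c \<in> C \<Longrightarrow> r c = c"
proof -
  interpret M: module K M by fact
  obtain D where D: "submodule D K M" and CD: "C \<inter> D \<subseteq> {\<zero>\<^bsub>M\<^esub>}"
    and ex: "\<And>x. x \<in> carrier M \<Longrightarrow> \<exists>c\<in>C. \<exists>d\<in>D. x = c \<oplus>\<^bsub>M\<^esub> d"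
    using complement_exists[OF assms] by blast
  note c = M.submoduleE[OF C] and d = M.submoduleE[OF D]
  have cc: "y \<in> C \<Longrightarrow> y \<in> carrier M" and dc: "y \<in> D \<Longrightarrow> y \<in> carrier M" for y
    using c(1) d(1) by auto
  \<comment> \<open>The difference of the two \<open>C\<close>-components equals a difference of
    \<open>D\<close>-components, hence lies in the trivial intersection.\<close>
  have uniq: "a = a'" if "a \<in> C" "b \<in> D" "a' \<in> C" "b' \<in> D" "a \<oplus>\<^bsub>M\<^esub> b = a' \<oplus>\<^bsub>M\<^esub> b'" for a b a' b'
  proof -
    note car = cc[OF that(1)] dc[OF that(2)] cc[OF that(3)] dc[OF that(4)]
    have "a \<oplus>\<^bsub>M\<^esub> (\<ominus>\<^bsub>M\<^esub> a') = (a \<oplus>\<^bsub>M\<^esub> b) \<oplus>\<^bsub>M\<^esub> (\<ominus>\<^bsub>M\<^esub> b \<oplus>\<^bsub>M\<^esub> \<ominus>\<^bsub>M\<^esub> a')"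
      using car by (simp add: M.M.a_assoc M.M.r_neg2)
    also have "\<dots> = b' \<oplus>\<^bsub>M\<^esub> (\<ominus>\<^bsub>M\<^esub> b)"
      unfolding that(5) using car by (simp add: M.M.a_ac) (simp add: M.M.a_lcomm[of a' b'] M.M.r_neg2)
    finally have eq: "a \<oplus>\<^bsub>M\<^esub> (\<ominus>\<^bsub>M\<^esub> a') = b' \<oplus>\<^bsub>M\<^esub> (\<ominus>\<^bsub>M\<^esub> b)" .
    have "a \<oplus>\<^bsub>M\<^esub> (\<ominus>\<^bsub>M\<^esub> a') \<in> C" using that c(3,5) by auto
    moreover have "a \<oplus>\<^bsub>M\<^esub> (\<ominus>\<^bsub>M\<^esub> a') \<in> D" unfolding eq using that d(3,5) by auto
    ultimately have "a \<oplus>\<^bsub>M\<^esub> (\<ominus>\<^bsub>M\<^esub> a') = \<zero>\<^bsub>M\<^esub>" using CD by blast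
    then show ?thesis using car by (metis M.M.a_inv_closed M.M.minus_equality M.M.minus_minus)
  qed
  define r where "r x = (THE a. a \<in> C \<and> (\<exists>b\<in>D. x = a \<oplus>\<^bsub>M\<^esub> b))" for x
  have r: "r (a \<oplus>\<^bsub>M\<^esub> b) = a" if "a \<in> C" "b \<in> D" for a b
    unfolding r_def by (rule the_equality) (use that uniq in blast)+
  have z: "\<zero>\<^bsub>M\<^esub> \<in> D" using subgroup.one_closed[OF submodule.axioms(1)[OF D]] by simp
  show thesis
  proof (rule that[of r])
    show "r a = a" if "a \<in> C" for a using r[OF that z] cc[OF that] by simp
    show "r \<in> linear_maps K M (M\<lparr>carrier := C\<rparr>)"
    proof (rule linear_mapsI)
      fix x assume "x \<in> carrier M"
      then obtain a b where x: "a \<in> C" "b \<in> D" "x = a \<oplus>\<^bsub>M\<^esub> b" using ex by blast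
      then show "r x \<in> carrier (M\<lparr>carrier := C\<rparr>)" using r by simp
      { fix y assume "y \<in> carrier M"
        then obtain a' b' where y: "a' \<in> C" "b' \<in> D" "y = a' \<oplus>\<^bsub>M\<^esub> b'" using ex by blast
        have "x \<oplus>\<^bsub>M\<^esub> y = (a \<oplus>\<^bsub>M\<^esub> a') \<oplus>\<^bsub>M\<^esub> (b \<oplus>\<^bsub>M\<^esub> b')"
          using x y cc dc by (simp add: M.M.a_ac)
        then show "r (x \<oplus>\<^bsub>M\<^esub> y) = r x \<oplus>\<^bsub>M\<lparr>carrier := C\<rparr>\<^esub> r y"
          using x y r c(5) d(5) by simp }
      fix k assume k: "k \<in> carrier K"
      have "k \<odot>\<^bsub>M\<^esub> x = k \<odot>\<^bsub>M\<^esub> a \<oplus>\<^bsub>M\<^esub> k \<odot>\<^bsub>M\<^esub> b"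
        using x k cc dc by (simp add: M.smult_r_distr)
      then show "r (k \<odot>\<^bsub>M\<^esub> x) = k \<odot>\<^bsub>M\<lparr>carrier := C\<rparr>\<^esub> r x"
        using x k r c(4) d(4) by simp
    qed
  qed
qed

section \<open>Induced coalgebras\<close>

text \<open>The construction reads only carrier, addition and scalar multiplication. Thus
  \<open>B\<close> with a replaced carrier and the induced coalgebra, which differ in
  \<open>comult\<close>, have the same tensor square.\<close>

lemma tensor_cong:
  assumes "carrier V = carrier V'" "ring.add V = ring.add V'" "smult V = smult V'"
    and "carrier W = carrier W'" "ring.add W = ring.add W'" "smult W = smult W'"
  shows "tensor K V W = tensor K V' W'"
proof -
  have A: "tensor_free K V W = tensor_free K V' W'" by (simp add: tensor_free_def assms)
  have "tensor_relations K V W = tensor_relations K V' W'"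
    by (simp add: tensor_relations_def A assms)
  then have "tensor_kernel K V W = tensor_kernel K V' W'" by (simp add: tensor_kernel_def A)
  then show ?thesis by (simp add: tensor_def A)
qed

text \<open>There is no rule for \<open>comult\<close>: its definite description is opened only in
  \<open>induced_comult\<close>, where existence and uniqueness are known.\<close>

lemma induced_coalgebra_simps [simp]:
  "carrier (induced_coalgebra K B C) = C"
  "ring.add (induced_coalgebra K B C) = ring.add B"
  "\<zero>\<^bsub>induced_coalgebra K B C\<^esub> = \<zero>\<^bsub>B\<^esub>"
  "smult (induced_coalgebra K B C) = smult B"
  "counit (induced_coalgebra K B C) = counit B"
  by (simp_all add: induced_coalgebra_def)

lemma module_induced_coalgebra:
  assumes "module K B" "submodule C K B"
  shows "module K (induced_coalgebra K B C)"
proof -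
  interpret module K "B\<lparr>carrier := C\<rparr>" by (rule submodule.submodule_is_module[OF assms(2,1)])
  have "abelian_group (induced_coalgebra K B C)"
    using M.abelian_group_axioms
    unfolding abelian_group_def abelian_monoid_def abelian_group_axioms_def by simp
  then show ?thesis
    using smult_l_distr smult_r_distr smult_assoc1 smult_closed smult_one
    by (intro moduleI R.is_cring) simp_all
qed

text \<open>A lift evaluates the representatives contained in the given coset, and its body never
  mentions the source modules. They can therefore be renamed at will, here from an updated record to
  the induced coalgebra.\<close>

lemma tensor_square_inclusion_eq:
  "tensor_square_inclusion K B C = tensor_map K V W B B (\<lambda>x. x) (\<lambda>x. x)"
  unfolding tensor_square_inclusion_def tensor_map_def tensor_lift_def ..

lemma submodule_subcoalgebra: "subcoalgebra C K B \<Longrightarrow> submodule C K B"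
  by (simp add: subcoalgebra_def)

context
  fixes K :: "('k, 'm) ring_scheme" and B :: "('k, 'b) coalgebra" and C :: "'b set"
begin

private abbreviation (input) "E \<equiv> induced_coalgebra K B C"
private abbreviation (input) "J \<equiv> tensor_square_inclusion K B C"

context
  assumes K: "field K" and B: "module K B" and C: "submodule C K B"
begin

lemma inclusion_linear: "(\<lambda>x. x) \<in> linear_maps K E B"
  by (rule linear_mapsI) (use module.submoduleE(1)[OF B C] in auto)

lemma inclusion_retraction:
  obtains r where "r \<in> linear_maps K B E" "\<And>c. c \<in> C \<Longrightarrow> r c = c"
proof -
  obtain r where r: "r \<in> linear_maps K B (B\<lparr>carrier := C\<rparr>)" "\<And>c. c \<in> C \<Longrightarrow> r c = c"
    by (rule linear_retraction[OF K B C]) (rule that)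
  have "r \<in> linear_maps K B E"
    by (rule linear_mapsI) (use linear_mapsD[OF r(1)] in simp_all)
  from this r(2) show thesis by (rule that)
qed

lemma tensor_square_inclusion_linear: "J \<in> linear_maps K (tensor K E E) (tensor K B B)"
  unfolding tensor_square_inclusion_eq[of K B C E E]
  by (intro tensor_map_linear module_induced_coalgebra B C inclusion_linear)

lemma tensor_square_inclusion_pure:
  assumes "x \<in> C" "y \<in> C"
  shows "J (pure_tensor K E E x y) = pure_tensor K B B x y"
  unfolding tensor_square_inclusion_eq[of K B C E E]
  by (rule tensor_map_pure) (simp_all add: module_induced_coalgebra B C inclusion_linear assms)

text \<open>The left inverse is the tensor square of a retraction. It is kept as a linear map
  because it becomes a factor of the left inverse on triple tensors.\<close>

lemma tensor_square_inclusion_left_inverse: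
  obtains q where "q \<in> linear_maps K (tensor K B B) (tensor K E E)"
    "\<And>t. t \<in> carrier (tensor K E E) \<Longrightarrow> q (J t) = t"
proof -
  note E = module_induced_coalgebra[OF B C]
  obtain r where r: "r \<in> linear_maps K B E" "\<And>c. c \<in> C \<Longrightarrow> r c = c"
    by (rule inclusion_retraction) (rule that)
  have "tensor_map K B B E E r r (J t) = t" if "t \<in> carrier (tensor K E E)" for t
    unfolding tensor_square_inclusion_eq[of K B C E E]
    by (rule tensor_map_left_inverse[OF E E B B inclusion_linear inclusion_linear r(1) r(1) _ _ that])
      (simp_all add: r(2))
  with tensor_map_linear[OF B B E E r(1) r(1)] show thesis by (rule that)
qed

lemma tensor_square_inclusion_inj: "inj_on J (carrier (tensor K E E))"
proof -
  obtain q where "q \<in> linear_maps K (tensor K B B) (tensor K E E)"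
    "\<And>t. t \<in> carrier (tensor K E E) \<Longrightarrow> q (J t) = t"
    by (rule tensor_square_inclusion_left_inverse) (rule that)
  then show ?thesis by (intro inj_on_inverseI)
qed

lemma tensor_induced_coalgebra: "tensor K (B\<lparr>carrier := C\<rparr>) (B\<lparr>carrier := C\<rparr>) = tensor K E E"
  by (rule tensor_cong) simp_all

text \<open>The hypothesis gives existence and injectivity of the inclusion gives uniqueness, so the
  definite description denotes.\<close>

lemma induced_comult:
  assumes "comult B c \<in> J ` carrier (tensor K E E)"
  shows "comult E c \<in> carrier (tensor K E E)" and "J (comult E c) = comult B c"
proof -
  from assms obtain t where t: "t \<in> carrier (tensor K E E)" "J t = comult B c" by auto
  have "comult E c = (THE t. t \<in> carrier (tensor K E E) \<and> J t = comult B c)"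
    unfolding tensor_induced_coalgebra[symmetric] by (simp add: induced_coalgebra_def)
  also have "\<dots> = t"
    by (rule the_equality) (use t tensor_square_inclusion_inj in \<open>auto dest: inj_onD\<close>)
  finally show "comult E c \<in> carrier (tensor K E E)" "J (comult E c) = comult B c"
    using t by simp_all
qed

end

section \<open>Transfer of the coalgebra axioms to a subcoalgebra\<close>

context
  assumes coalgebra: "coalgebra K B" and sub: "subcoalgebra C K B"
begin

interpretation B: coalgebra K B by (rule coalgebra)

private lemmas ctx = B.K.field_axioms B.module_axioms submodule_subcoalgebra[OF sub]

lemma subcoalgebra_comult:
  assumes "c \<in> C"
  shows "comult E c \<in> carrier (tensor K E E)" and "J (comult E c) = comult B c"
  using assms sub induced_comult[OF ctx, of c] tensor_induced_coalgebra[OF ctx]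
  by (auto simp: subcoalgebra_def)

text \<open>The induced comultiplication is known only through its image under \<open>J\<close>;
  each law holds there by linearity of \<open>comult B\<close> and is pulled back by
  injectivity.\<close>

lemma induced_comult_linear: "comult E \<in> linear_maps K E (tensor K E E)"
proof -
  interpret E: module K E by (rule module_induced_coalgebra[OF ctx(2,3)])
  interpret EE: module K "tensor K E E" by (intro module_tensor E.module_axioms)
  note J = linear_mapsD[OF tensor_square_inclusion_linear[OF ctx]]
    and inj = inj_onD[OF tensor_square_inclusion_inj[OF ctx]]
  note comult = linear_mapsD[OF B.comult_linear] and D = subcoalgebra_comult
  have sub: "x \<in> C \<Longrightarrow> x \<in> carrier B" for x using B.submoduleE(1)[OF ctx(3)] by auto
  show ?thesis
  proof (rule linear_mapsI)
    fix x assume x: "x \<in> carrier E"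
    then show "comult E x \<in> carrier (tensor K E E)" using D by simp
    fix y assume y: "y \<in> carrier E"
    show "comult E (x \<oplus>\<^bsub>E\<^esub> y) = comult E x \<oplus>\<^bsub>tensor K E E\<^esub> comult E y"
      by (rule inj) (use x y E.M.a_closed[OF x y] in \<open>simp_all add: D J comult sub\<close>)
  next
    fix k x assume x: "k \<in> carrier K" "x \<in> carrier E"
    show "comult E (k \<odot>\<^bsub>E\<^esub> x) = k \<odot>\<^bsub>tensor K E E\<^esub> comult E x"
      by (rule inj) (use x E.smult_closed[OF x] in \<open>simp_all add: D J comult sub\<close>)
  qed
qed

text \<open>Coassociativity is an identity of triple tensors and is checked after the injective map
  \<open>?J3\<close>. The counit laws have values in \<open>C\<close> itself, so there it suffices
  to evaluate the same lifts with target \<open>B\<close>.\<close>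

lemma coalgebra_induced_coalgebra: "coalgebra K E"
proof -
  interpret E: module K E by (rule module_induced_coalgebra[OF ctx(2,3)])
  note modE = E.module_axioms and modB = ctx(2)
  note modEE = module_tensor[OF modE modE] and modBB = module_tensor[OF modB modB]
  note i = inclusion_linear[OF ctx]
  note J = tensor_square_inclusion_linear[OF ctx]
  note D = subcoalgebra_comult and DE = induced_comult_linear and DB = B.comult_linear
  note Jeq = tensor_square_inclusion_eq[of K B C E E]
  have sub: "x \<in> C \<Longrightarrow> x \<in> carrier B" for x using B.submoduleE(1)[OF ctx(3)] by auto
  obtain r where r: "r \<in> linear_maps K B E" "\<And>c. c \<in> C \<Longrightarrow> r c = c"
    by (rule inclusion_retraction[OF ctx]) (rule that)
  obtain q where q: "q \<in> linear_maps K (tensor K B B) (tensor K E E)"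
    "\<And>t. t \<in> carrier (tensor K E E) \<Longrightarrow> q (J t) = t"
    by (rule tensor_square_inclusion_left_inverse[OF ctx]) (rule that)
  let ?J3 = "tensor_map K E (tensor K E E) B (tensor K B B) (\<lambda>x. x) J"
  let ?q3 = "tensor_map K B (tensor K B B) E (tensor K E E) r q"
  have q3: "?q3 (?J3 t) = t" if "t \<in> carrier (tensor K E (tensor K E E))" for t
    by (rule tensor_map_left_inverse[OF modE modEE modB modBB i J r(1) q(1) _ _ that])
      (simp_all add: r(2) q(2))
  show ?thesis
  proof (rule coalgebra.intro, rule B.K.field_axioms, rule modE, unfold_locales)
    show "comult E \<in> linear_maps K E (tensor K E E)" by (rule DE)
    show "counit E \<in> linear_maps K E (ground_module K)"
      using linear_map_comp[OF i B.counit_linear] by simp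
  next
    fix c assume "c \<in> carrier E"
    then have c: "c \<in> C" by simp
    note Dc = D(1)[OF c]
    let ?l = "tensor_assoc K E E E (tensor_map K E E (tensor K E E) E (comult E) (\<lambda>x. x) (comult E c))"
    let ?r = "tensor_map K E E E (tensor K E E) (\<lambda>x. x) (comult E) (comult E c)"
    have 1: "tensor_map K E E (tensor K E E) E (comult E) (\<lambda>x. x) (comult E c)
        \<in> carrier (tensor K (tensor K E E) E)"
      by (rule linear_mapsD(1)[OF tensor_map_linear[OF modE modE modEE modE DE linear_map_id] Dc])
    have l: "?l \<in> carrier (tensor K E (tensor K E E))"
      by (rule linear_mapsD(1)[OF tensor_assoc_linear[OF modE modE modE] 1])
    have r': "?r \<in> carrier (tensor K E (tensor K E E))"
      by (rule linear_mapsD(1)[OF tensor_map_linear[OF modE modE modE modEE linear_map_id DE] Dc])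
    have JD: "(\<lambda>x. J (comult E x)) \<in> linear_maps K E (tensor K B B)"
      by (rule linear_map_comp[OF DE J])
    have DBi: "(\<lambda>x. comult B x) \<in> linear_maps K E (tensor K B B)"
      using linear_map_comp[OF i DB] .
    \<comment> \<open>Naturality moves the inclusions inside the rebracketing, functoriality merges
      them with the comultiplications, and on \<open>C\<close> the composite of \<open>J\<close>
      with \<open>comult E\<close> becomes \<open>comult B\<close>. After coassociativity of
      \<open>B\<close> the same moves are undone on the other side.\<close>
    have "?J3 ?l = tensor_assoc K B B B
        (tensor_map K (tensor K E E) E (tensor K B B) B J (\<lambda>x. x)
          (tensor_map K E E (tensor K E E) E (comult E) (\<lambda>x. x) (comult E c)))"
      unfolding Jeq
      by (rule tensor_assoc_natural[OF modE modE modE modB modB modB i i i 1])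
    also have "tensor_map K (tensor K E E) E (tensor K B B) B J (\<lambda>x. x)
          (tensor_map K E E (tensor K E E) E (comult E) (\<lambda>x. x) (comult E c)) =
        tensor_map K E E (tensor K B B) B (\<lambda>x. J (comult E x)) (\<lambda>x. x) (comult E c)"
      by (rule tensor_map_comp[OF modE modE modEE modE DE linear_map_id modBB modB J i Dc])
    also have "\<dots> = tensor_map K E E (tensor K B B) B (\<lambda>x. comult B x) (\<lambda>x. x) (comult E c)"
      by (rule tensor_map_cong[OF modE modE modBB modB JD i DBi i _ _ Dc]) (simp_all add: D)
    also have "\<dots> = tensor_map K B B (tensor K B B) B (comult B) (\<lambda>x. x) (J (comult E c))"
      unfolding Jeq
      by (rule tensor_map_comp[OF modE modE modB modB i i modBB modB DB linear_map_id Dc, symmetric])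
    also have "J (comult E c) = comult B c" by (rule D(2)[OF c])
    also have "tensor_assoc K B B B (tensor_map K B B (tensor K B B) B (comult B) (\<lambda>x. x) (comult B c)) =
        tensor_map K B B B (tensor K B B) (\<lambda>x. x) (comult B) (comult B c)"
      by (rule B.coassociative[OF sub[OF c]])
    also have "\<dots> = tensor_map K B B B (tensor K B B) (\<lambda>x. x) (comult B) (J (comult E c))"
      by (simp add: D(2)[OF c])
    also have "\<dots> = tensor_map K E E B (tensor K B B) (\<lambda>x. x) (\<lambda>x. comult B x) (comult E c)"
      unfolding Jeq
      by (rule tensor_map_comp[OF modE modE modB modB i i modB modBB linear_map_id DB Dc])
    also have "\<dots> = tensor_map K E E B (tensor K B B) (\<lambda>x. x) (\<lambda>x. J (comult E x)) (comult E c)"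
      by (rule tensor_map_cong[OF modE modE modB modBB i DBi i JD _ _ Dc]) (simp_all add: D)
    also have "\<dots> = ?J3 ?r"
      by (rule tensor_map_comp[OF modE modE modE modEE linear_map_id DE modB modBB i J Dc, symmetric])
    finally show "?l = ?r" using q3[OF l] q3[OF r'] by metis
    have bB: "(\<lambda>x y. counit B x \<odot>\<^bsub>B\<^esub> y) \<in> bilinear_maps K B B B"
      "(\<lambda>x y. counit B y \<odot>\<^bsub>B\<^esub> x) \<in> bilinear_maps K B B B"
      using linear_mapsD[OF B.counit_linear]
      by (auto intro!: bilinear_mapsI simp: ground_module_def B.smult_l_distr B.smult_r_distr
        B.K.m_comm simp flip: B.smult_assoc1)
    have bE: "(\<lambda>x y. counit E x \<odot>\<^bsub>E\<^esub> y) \<in> bilinear_maps K E E E"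
      "(\<lambda>x y. counit E y \<odot>\<^bsub>E\<^esub> x) \<in> bilinear_maps K E E E"
      using bilinear_mapsD[OF bB(1)] bilinear_mapsD[OF bB(2)] linear_mapsD(1)[OF B.counit_linear] sub
        E.smult_closed
      by (auto intro!: bilinear_mapsI simp: ground_module_def)
    \<comment> \<open>The intermediate pairing takes arguments in \<open>C\<close> and values in
      \<open>B\<close>: it differs from the pairing on \<open>C\<close> only in the target, and from
      the one on \<open>B\<close> only in the source.\<close>
    have bEB: "(\<lambda>x y. counit B x \<odot>\<^bsub>B\<^esub> y) \<in> bilinear_maps K E E B"
      "(\<lambda>x y. counit B y \<odot>\<^bsub>B\<^esub> x) \<in> bilinear_maps K E E B"
      by (rule bilinear_maps_comp[OF bB(1) i i linear_map_id] bilinear_maps_comp[OF bB(2) i i linear_map_id])+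
    have "tensor_lift K E E E (\<lambda>x y. counit E x \<odot>\<^bsub>E\<^esub> y) (comult E c) =
        tensor_lift K E E B (\<lambda>x y. counit B x \<odot>\<^bsub>B\<^esub> y) (comult E c)"
      by (rule linear_map_tensor_lift[OF modE modE modE modB bE(1) i bEB(1) _ Dc]) simp
    also have "\<dots> = tensor_lift K B B B (\<lambda>x y. counit B x \<odot>\<^bsub>B\<^esub> y) (J (comult E c))"
      unfolding Jeq
      by (rule tensor_lift_tensor_map[OF modE modE modB modB modB i i bB(1) bEB(1) _ Dc, symmetric]) simp
    also have "\<dots> = c" using B.counit_left[OF sub[OF c]] by (simp add: D(2)[OF c])
    finally show "tensor_lift K E E E (\<lambda>x y. counit E x \<odot>\<^bsub>E\<^esub> y) (comult E c) = c" .
    have "tensor_lift K E E E (\<lambda>x y. counit E y \<odot>\<^bsub>E\<^esub> x) (comult E c) =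
        tensor_lift K E E B (\<lambda>x y. counit B y \<odot>\<^bsub>B\<^esub> x) (comult E c)"
      by (rule linear_map_tensor_lift[OF modE modE modE modB bE(2) i bEB(2) _ Dc]) simp
    also have "\<dots> = tensor_lift K B B B (\<lambda>x y. counit B y \<odot>\<^bsub>B\<^esub> x) (J (comult E c))"
      unfolding Jeq
      by (rule tensor_lift_tensor_map[OF modE modE modB modB modB i i bB(2) bEB(2) _ Dc, symmetric]) simp
    also have "\<dots> = c" using B.counit_right[OF sub[OF c]] by (simp add: D(2)[OF c])
    finally show "tensor_lift K E E E (\<lambda>x y. counit E y \<odot>\<^bsub>E\<^esub> x) (comult E c) = c" .
  qed
qed

end

end

section \<open>Multiplication and unit of a bialgebra on subcoalgebras\<close>

lemma tensor_coalgebra_simps: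
  "carrier (tensor_coalgebra K C D) = carrier (tensor K C D)"
  "ring.add (tensor_coalgebra K C D) = ring.add (tensor K C D)"
  "smult (tensor_coalgebra K C D) = smult (tensor K C D)"
  "comult (tensor_coalgebra K C D) = (\<lambda>t. tensor_interchange K C C D D
      (tensor_map K C D (tensor K C C) (tensor K D D) (comult C) (comult D) t))"
  "counit (tensor_coalgebra K C D) =
    tensor_lift K C D (ground_module K) (\<lambda>c d. counit C c \<otimes>\<^bsub>K\<^esub> counit D d)"
  by (simp_all add: tensor_coalgebra_def module.defs coalgebra.defs)

lemma unit_coalgebra_simps:
  "carrier (unit_coalgebra K) = carrier K"
  "ring.add (unit_coalgebra K) = ring.add K"
  "smult (unit_coalgebra K) = monoid.mult K"
  "comult (unit_coalgebra K) = (\<lambda>c. pure_tensor K (ground_module K) (ground_module K) c \<one>\<^bsub>K\<^esub>)"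
  "counit (unit_coalgebra K) = (\<lambda>c. c)"
  by (simp_all add: unit_coalgebra_def ground_module_def module.defs coalgebra.defs)

lemma module_ground_module:
  assumes "cring K"
  shows "module K (ground_module K)"
proof -
  interpret cring K by fact
  show ?thesis
  proof (intro moduleI abelian_groupI assms)
    fix x assume "x \<in> carrier (ground_module K)"
    then show "\<exists>y\<in>carrier (ground_module K). y \<oplus>\<^bsub>ground_module K\<^esub> x = \<zero>\<^bsub>ground_module K\<^esub>"
      by (intro bexI[of _ "\<ominus>\<^bsub>K\<^esub> x"]) (simp_all add: ground_module_def l_neg)
  qed (simp_all add: ground_module_def l_distr r_distr m_assoc a_ac)
qed

text \<open>\<open>coalgebra_hom\<close> names the source as a coalgebra record, while the facts
  about tensor maps are stated for the underlying module. This lemma switches between them.\<close>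

lemma tensor_map_source_irrelevant: "tensor_map K V W P Q f g = tensor_map K V' W' P Q f g"
  unfolding tensor_map_def tensor_lift_def ..

context
  fixes K :: "('k, 'm) ring_scheme" and B :: "('k, 'b) coalgebra"
  assumes bialgebra: "bialgebra K B"
begin

interpretation B: bialgebra K B by (rule bialgebra)

private abbreviation (input) "\<E> C \<equiv> induced_coalgebra K B C"
private abbreviation (input) "\<J> C \<equiv> tensor_square_inclusion K B C"

lemma bialgebra_mult_bilinear: "monoid.mult B \<in> bilinear_maps K B B B"
  by (rule bilinear_mapsI) (simp_all add: B.B.l_distr B.B.r_distr B.smult_mult_left B.smult_mult_right)

text \<open>The product of the tensor algebra is written out with \<open>tensor_interchange\<close>,
  the map that also occurs in the comultiplication of \<open>tensor_coalgebra\<close>; this makes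
  the two comparable.\<close>

lemma bialgebra_comult_mult:
  assumes "x \<in> carrier B" "y \<in> carrier B"
  shows "comult B (x \<otimes>\<^bsub>B\<^esub> y) =
    tensor_map K (tensor K B B) (tensor K B B) B B
      (tensor_lift K B B B (monoid.mult B)) (tensor_lift K B B B (monoid.mult B))
      (tensor_interchange K B B B B
        (pure_tensor K (tensor K B B) (tensor K B B) (comult B x) (comult B y)))"
  using ring_hom_mult[OF B.comult_ring_hom assms] by (simp add: tensor_algebra_def)

text \<open>Compatibility with comultiplication is multiplicativity of \<open>comult B\<close>, read
  inside the tensor square of \<open>F\<close>. The inclusion \<open>\<J> F\<close> is injective, so
  it is enough to compare images in the tensor square of \<open>B\<close>.\<close>

lemma subcoalgebra_mult_coalgebra_hom:
  assumes C: "subcoalgebra C K B" and D: "subcoalgebra D K B" and F: "subcoalgebra F K B"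
    and CD: "\<And>c d. \<lbrakk>c \<in> C; d \<in> D\<rbrakk> \<Longrightarrow> c \<otimes>\<^bsub>B\<^esub> d \<in> F"
  shows "monoid.mult B \<in> bilinear_maps K (\<E> C) (\<E> D) (\<E> F)"
    and "tensor_lift K (\<E> C) (\<E> D) (\<E> F) (monoid.mult B)
      \<in> coalgebra_hom K (tensor_coalgebra K (\<E> C) (\<E> D)) (\<E> F)"
proof -
  note cB = B.coalgebra_axioms
  note ctx = B.K.field_axioms B.module_axioms
  note sub = C[THEN submodule_subcoalgebra] D[THEN submodule_subcoalgebra] F[THEN submodule_subcoalgebra]
  note mC = module_induced_coalgebra[OF ctx(2) sub(1)] and mD = module_induced_coalgebra[OF ctx(2) sub(2)]
    and mF = module_induced_coalgebra[OF ctx(2) sub(3)] and mB = ctx(2)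
  note mCC = module_tensor[OF mC mC] and mDD = module_tensor[OF mD mD] and mFF = module_tensor[OF mF mF]
    and mCD = module_tensor[OF mC mD] and mBB = module_tensor[OF mB mB]
  note mG = module_ground_module[OF B.K.is_cring]
  note iC = inclusion_linear[OF ctx sub(1)] and iD = inclusion_linear[OF ctx sub(2)]
    and iF = inclusion_linear[OF ctx sub(3)]
  note dC = induced_comult_linear[OF cB C] and dD = induced_comult_linear[OF cB D]
    and dF = induced_comult_linear[OF cB F]
  note JC = tensor_square_inclusion_linear[OF ctx sub(1)] and JD = tensor_square_inclusion_linear[OF ctx sub(2)]
    and JF = tensor_square_inclusion_linear[OF ctx sub(3)]
  have car: "x \<in> C \<Longrightarrow> x \<in> carrier B" "x \<in> D \<Longrightarrow> x \<in> carrier B" for x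
    using B.submoduleE(1) sub by auto
  note counit = linear_mapsD[OF B.counit_linear, unfolded ground_module_def, simplified]
  note b = bilinear_mapsD[OF bialgebra_mult_bilinear]
  show bil: "monoid.mult B \<in> bilinear_maps K (\<E> C) (\<E> D) (\<E> F)"
    by (rule bilinear_mapsI) (simp_all add: CD b car)
  let ?m = "tensor_lift K (\<E> C) (\<E> D) (\<E> F) (monoid.mult B)"
  let ?\<mu> = "tensor_lift K B B B (monoid.mult B)"
  note m = tensor_lift_linear[OF mC mD mF bil] and m_pure = tensor_lift_pure[OF mC mD mF bil]
  note \<mu> = tensor_lift_linear[OF mB mB mB bialgebra_mult_bilinear]
    and \<mu>_pure = tensor_lift_pure[OF mB mB mB bialgebra_mult_bilinear]
  note mm = tensor_map_linear[OF mCD mCD mF mF m m] and \<mu>\<mu> = tensor_map_linear[OF mBB mBB mB mB \<mu> \<mu>]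
  note JJ = tensor_map_linear[OF mCC mDD mBB mBB JC JD]
  \<comment> \<open>Interchanging and multiplying commutes with the inclusions. Both sides send the
    quadruple \<open>u\<close>, \<open>v\<close>, \<open>x\<close>, \<open>y\<close> to the pure
    tensor of the products \<open>u x\<close> and \<open>v y\<close> in \<open>B\<close>.\<close>
  have natural: "\<J> F (tensor_map K (tensor K (\<E> C) (\<E> D)) (tensor K (\<E> C) (\<E> D)) (\<E> F) (\<E> F) ?m ?m
        (tensor_interchange K (\<E> C) (\<E> C) (\<E> D) (\<E> D) z)) =
      tensor_map K (tensor K B B) (tensor K B B) B B ?\<mu> ?\<mu> (tensor_interchange K B B B B
        (tensor_map K (tensor K (\<E> C) (\<E> C)) (tensor K (\<E> D) (\<E> D)) (tensor K B B) (tensor K B B)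
          (\<J> C) (\<J> D) z))" (is "?L z = ?R z")
    if "z \<in> carrier (tensor K (tensor K (\<E> C) (\<E> C)) (tensor K (\<E> D) (\<E> D)))" for z
  proof (rule tensor_ext_both[OF mC mC mD mD mBB _ _ _ that])
    show "?L \<in> linear_maps K (tensor K (tensor K (\<E> C) (\<E> C)) (tensor K (\<E> D) (\<E> D))) (tensor K B B)"
      by (rule linear_map_comp[OF linear_map_comp[OF tensor_interchange_linear[OF mC mC mD mD] mm] JF])
    show "?R \<in> linear_maps K (tensor K (tensor K (\<E> C) (\<E> C)) (tensor K (\<E> D) (\<E> D))) (tensor K B B)"
      by (rule linear_map_comp[OF linear_map_comp[OF JJ tensor_interchange_linear[OF mB mB mB mB]] \<mu>\<mu>])
    fix u v x y assume "u \<in> carrier (\<E> C)" "v \<in> carrier (\<E> C)" "x \<in> carrier (\<E> D)" "y \<in> carrier (\<E> D)"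
    then show "?L (pure_tensor K (tensor K (\<E> C) (\<E> C)) (tensor K (\<E> D) (\<E> D))
        (pure_tensor K (\<E> C) (\<E> C) u v) (pure_tensor K (\<E> D) (\<E> D) x y)) =
      ?R (pure_tensor K (tensor K (\<E> C) (\<E> C)) (tensor K (\<E> D) (\<E> D))
        (pure_tensor K (\<E> C) (\<E> C) u v) (pure_tensor K (\<E> D) (\<E> D) x y))"
      by (simp add: tensor_interchange_pure[OF mC mC mD mD] tensor_interchange_pure[OF mB mB mB mB]
        tensor_map_pure[OF mCD mCD mF mF m m] tensor_map_pure[OF mBB mBB mB mB \<mu> \<mu>]
        tensor_map_pure[OF mCC mDD mBB mBB JC JD] m_pure \<mu>_pure CD car
        pure_tensor_closed[OF mC mC] pure_tensor_closed[OF mD mD] pure_tensor_closed[OF mC mD]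
        pure_tensor_closed[OF mB mB]
        tensor_square_inclusion_pure[OF ctx sub(1)] tensor_square_inclusion_pure[OF ctx sub(2)]
        tensor_square_inclusion_pure[OF ctx sub(3)])
  qed
  note dd = tensor_map_linear[OF mC mD mCC mDD dC dD]
  note swap = tensor_interchange_linear[OF mC mC mD mD]
  have comult: "comult (\<E> F) (?m t) = tensor_map K (tensor K (\<E> C) (\<E> D)) (tensor K (\<E> C) (\<E> D)) (\<E> F) (\<E> F) ?m ?m
      (tensor_interchange K (\<E> C) (\<E> C) (\<E> D) (\<E> D)
        (tensor_map K (\<E> C) (\<E> D) (tensor K (\<E> C) (\<E> C)) (tensor K (\<E> D) (\<E> D))
          (comult (\<E> C)) (comult (\<E> D)) t))"
    if "t \<in> carrier (tensor K (\<E> C) (\<E> D))" for t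
  proof (rule tensor_ext[OF mC mD mFF linear_map_comp[OF m dF]
      linear_map_comp[OF linear_map_comp[OF dd swap] mm] _ that])
    fix c d assume "c \<in> carrier (\<E> C)" "d \<in> carrier (\<E> D)"
    then have c: "c \<in> C" and d: "d \<in> D" by auto
    note \<Delta>c = subcoalgebra_comult[OF cB C c] and \<Delta>d = subcoalgebra_comult[OF cB D d]
      and \<Delta>cd = subcoalgebra_comult[OF cB F CD[OF c d]]
    let ?z = "pure_tensor K (tensor K (\<E> C) (\<E> C)) (tensor K (\<E> D) (\<E> D)) (comult (\<E> C) c) (comult (\<E> D) d)"
    have z: "?z \<in> carrier (tensor K (tensor K (\<E> C) (\<E> C)) (tensor K (\<E> D) (\<E> D)))"
      by (rule pure_tensor_closed[OF mCC mDD \<Delta>c(1) \<Delta>d(1)])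
    let ?w = "tensor_map K (tensor K (\<E> C) (\<E> D)) (tensor K (\<E> C) (\<E> D)) (\<E> F) (\<E> F) ?m ?m
      (tensor_interchange K (\<E> C) (\<E> C) (\<E> D) (\<E> D) ?z)"
    have w: "?w \<in> carrier (tensor K (\<E> F) (\<E> F))"
      by (rule linear_mapsD(1)[OF linear_map_comp[OF swap mm] z])
    \<comment> \<open>By naturality the computation moves to \<open>B\<close>, where the inclusions
      turn the induced comultiplications of \<open>c\<close> and \<open>d\<close> into those of
      \<open>B\<close>.\<close>
    have "\<J> F ?w = tensor_map K (tensor K B B) (tensor K B B) B B ?\<mu> ?\<mu> (tensor_interchange K B B B B
        (pure_tensor K (tensor K B B) (tensor K B B) (comult B c) (comult B d)))"
      unfolding natural[OF z] tensor_map_pure[OF mCC mDD mBB mBB JC JD \<Delta>c(1) \<Delta>d(1)] \<Delta>c(2) \<Delta>d(2) ..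
    also have "\<dots> = \<J> F (comult (\<E> F) (c \<otimes>\<^bsub>B\<^esub> d))"
      unfolding \<Delta>cd(2) by (rule bialgebra_comult_mult[OF car(1)[OF c] car(2)[OF d], symmetric])
    finally have "comult (\<E> F) (c \<otimes>\<^bsub>B\<^esub> d) = ?w"
      using inj_onD[OF tensor_square_inclusion_inj[OF ctx sub(3)] _ \<Delta>cd(1) w] by simp
    then show "comult (\<E> F) (?m (pure_tensor K (\<E> C) (\<E> D) c d)) =
      tensor_map K (tensor K (\<E> C) (\<E> D)) (tensor K (\<E> C) (\<E> D)) (\<E> F) (\<E> F) ?m ?m
      (tensor_interchange K (\<E> C) (\<E> C) (\<E> D) (\<E> D)
        (tensor_map K (\<E> C) (\<E> D) (tensor K (\<E> C) (\<E> C)) (tensor K (\<E> D) (\<E> D))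
          (comult (\<E> C)) (comult (\<E> D)) (pure_tensor K (\<E> C) (\<E> D) c d)))"
      using c d by (simp add: m_pure tensor_map_pure[OF mC mD mCC mDD dC dD])
  qed
  have eF: "counit B \<in> linear_maps K (\<E> F) (ground_module K)"
    using linear_map_comp[OF iF B.counit_linear] by simp
  have ebil: "(\<lambda>c d. counit B c \<otimes>\<^bsub>K\<^esub> counit B d) \<in> bilinear_maps K (\<E> C) (\<E> D) (ground_module K)"
    by (rule bilinear_mapsI)
      (simp_all add: ground_module_def counit car B.K.l_distr B.K.r_distr B.K.m_ac)
  \<comment> \<open>The counit of the tensor coalgebra is itself a lift, so the claim reduces to
    multiplicativity of the counit of \<open>B\<close> on pairs.\<close>
  have counit: "counit B (?m t) =
      tensor_lift K (\<E> C) (\<E> D) (ground_module K) (\<lambda>c d. counit B c \<otimes>\<^bsub>K\<^esub> counit B d) t"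
    if "t \<in> carrier (tensor K (\<E> C) (\<E> D))" for t
    by (rule linear_map_tensor_lift[OF mC mD mF mG bil eF ebil _ that])
      (use ring_hom_mult[OF B.counit_ring_hom] car in auto)
  show "?m \<in> coalgebra_hom K (tensor_coalgebra K (\<E> C) (\<E> D)) (\<E> F)"
    unfolding coalgebra_hom_def
  proof (intro CollectI conjI ballI)
    show "?m \<in> linear_maps K (tensor_coalgebra K (\<E> C) (\<E> D)) (\<E> F)"
      by (rule linear_mapsI) (use linear_mapsD[OF m] in \<open>simp_all add: tensor_coalgebra_simps\<close>)
    fix t assume t: "t \<in> carrier (tensor_coalgebra K (\<E> C) (\<E> D))"
    then have t': "t \<in> carrier (tensor K (\<E> C) (\<E> D))" by (simp add: tensor_coalgebra_simps)
    show "comult (\<E> F) (?m t) = tensor_map K (tensor_coalgebra K (\<E> C) (\<E> D)) (tensor_coalgebra K (\<E> C) (\<E> D))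
        (\<E> F) (\<E> F) ?m ?m (comult (tensor_coalgebra K (\<E> C) (\<E> D)) t)"
      unfolding comult[OF t'] tensor_coalgebra_simps
      by (rule fun_cong[OF tensor_map_source_irrelevant])
    show "counit (\<E> F) (?m t) = counit (tensor_coalgebra K (\<E> C) (\<E> D)) t"
      using counit[OF t'] by (simp add: tensor_coalgebra_simps)
  qed
qed

text \<open>The comultiplication of \<open>B\<close> sends the unit to its tensor square; with the
  scalar \<open>k\<close> moved to the left factor this matches the image of \<open>k\<close>
  tensored with one. The equation is then pulled back along \<open>\<J> C\<close>.\<close>

lemma subcoalgebra_unit_coalgebra_hom:
  assumes C: "subcoalgebra C K B" and one: "\<one>\<^bsub>B\<^esub> \<in> C"
  shows "(\<lambda>k. k \<odot>\<^bsub>\<E> C\<^esub> \<one>\<^bsub>B\<^esub>) \<in> coalgebra_hom K (unit_coalgebra K) (\<E> C)"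
proof -
  note cB = B.coalgebra_axioms
  note ctx = B.K.field_axioms B.module_axioms submodule_subcoalgebra[OF C]
  interpret E: module K "\<E> C" by (rule module_induced_coalgebra[OF ctx(2,3)])
  note mG = module_ground_module[OF B.K.is_cring]
  note mE = E.module_axioms and mB = B.module_axioms
  note counit = linear_mapsD[OF B.counit_linear, unfolded ground_module_def, simplified]
  let ?u = "\<lambda>k. k \<odot>\<^bsub>B\<^esub> \<one>\<^bsub>B\<^esub>"
  have smult: "k \<odot>\<^bsub>B\<^esub> \<one>\<^bsub>B\<^esub> \<in> C" if "k \<in> carrier K" for k
    using E.smult_closed[OF that] one by simp
  have u: "?u \<in> linear_maps K (ground_module K) (\<E> C)"
    by (rule linear_mapsI)
      (simp_all add: ground_module_def smult B.smult_l_distr B.smult_assoc1)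
  show ?thesis
    unfolding coalgebra_hom_def induced_coalgebra_simps
  proof (intro CollectI conjI ballI)
    show "?u \<in> linear_maps K (unit_coalgebra K) (\<E> C)"
      by (rule linear_mapsI) (use linear_mapsD[OF u] in \<open>simp_all add: unit_coalgebra_simps ground_module_def\<close>)
    fix k assume "k \<in> carrier (unit_coalgebra K)"
    then have k: "k \<in> carrier K" by (simp add: unit_coalgebra_simps)
    have "counit B \<one>\<^bsub>B\<^esub> = \<one>\<^bsub>K\<^esub>" by (rule ring_hom_one[OF B.counit_ring_hom])
    then show "counit B (?u k) = counit (unit_coalgebra K) k"
      using k by (simp add: unit_coalgebra_simps counit)
    have "tensor_map K (unit_coalgebra K) (unit_coalgebra K) (\<E> C) (\<E> C) ?u ?u
        (comult (unit_coalgebra K) k) =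
      tensor_map K (ground_module K) (ground_module K) (\<E> C) (\<E> C) ?u ?u
        (pure_tensor K (ground_module K) (ground_module K) k \<one>\<^bsub>K\<^esub>)"
      unfolding unit_coalgebra_simps by (rule fun_cong[OF tensor_map_source_irrelevant])
    also have "\<dots> = pure_tensor K (\<E> C) (\<E> C) (?u k) \<one>\<^bsub>B\<^esub>"
      using k by (subst tensor_map_pure[OF mG mG mE mE u u]) (simp_all add: ground_module_def)
    finally have r: "tensor_map K (unit_coalgebra K) (unit_coalgebra K) (\<E> C) (\<E> C) ?u ?u
        (comult (unit_coalgebra K) k) = pure_tensor K (\<E> C) (\<E> C) (?u k) \<one>\<^bsub>B\<^esub>" .
    have "\<J> C (comult (\<E> C) (?u k)) = comult B (?u k)"
      by (rule subcoalgebra_comult(2)[OF cB C smult[OF k]])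
    also have "\<dots> = k \<odot>\<^bsub>tensor K B B\<^esub> comult B \<one>\<^bsub>B\<^esub>"
      using linear_mapsD(3)[OF B.comult_linear k] by simp
    also have "comult B \<one>\<^bsub>B\<^esub> = pure_tensor K B B \<one>\<^bsub>B\<^esub> \<one>\<^bsub>B\<^esub>"
      using ring_hom_one[OF B.comult_ring_hom] by (simp add: tensor_algebra_def)
    also have "k \<odot>\<^bsub>tensor K B B\<^esub> \<dots> = pure_tensor K B B (?u k) \<one>\<^bsub>B\<^esub>"
      using bilinear_mapsD(4)[OF pure_tensor_bilinear[OF mB mB] k] by simp
    also have "\<dots> = \<J> C (pure_tensor K (\<E> C) (\<E> C) (?u k) \<one>\<^bsub>B\<^esub>)"
      by (rule tensor_square_inclusion_pure[OF ctx smult[OF k] one, symmetric])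
    finally have "comult (\<E> C) (?u k) = pure_tensor K (\<E> C) (\<E> C) (?u k) \<one>\<^bsub>B\<^esub>"
      by (rule inj_onD[OF tensor_square_inclusion_inj[OF ctx]])
        (use pure_tensor_closed[OF mE mE] smult[OF k] one subcoalgebra_comult(1)[OF cB C] in auto)
    then show "comult (\<E> C) (?u k) = tensor_map K (unit_coalgebra K) (unit_coalgebra K) (\<E> C) (\<E> C) ?u ?u
        (comult (unit_coalgebra K) k)"
      using r by simp
  qed
qed

text \<open>Linear maps preserve zero, so the comultiplication of zero is the included zero tensor.
  This provides the vanishing Hom-spaces of both categories.\<close>

lemma subcoalgebra_zero: "subcoalgebra {\<zero>\<^bsub>B\<^esub>} K B"
proof -
  have s: "submodule {\<zero>\<^bsub>B\<^esub>} K B" by (rule B.submoduleI) auto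
  note ctx = B.K.field_axioms B.module_axioms s
  note mE = module_induced_coalgebra[OF ctx(2,3)]
  note mEE = module_tensor[OF mE mE] and mBB = module_tensor[OF ctx(2) ctx(2)]
  have "comult B \<zero>\<^bsub>B\<^esub> = \<J> {\<zero>\<^bsub>B\<^esub>} \<zero>\<^bsub>tensor K (\<E> {\<zero>\<^bsub>B\<^esub>}) (\<E> {\<zero>\<^bsub>B\<^esub>})\<^esub>"
    using linear_map_zero[OF mEE mBB tensor_square_inclusion_linear[OF ctx]]
      linear_map_zero[OF ctx(2) mBB B.comult_linear] by simp
  moreover have "\<zero>\<^bsub>tensor K (\<E> {\<zero>\<^bsub>B\<^esub>}) (\<E> {\<zero>\<^bsub>B\<^esub>})\<^esub> \<in> carrier (tensor K (\<E> {\<zero>\<^bsub>B\<^esub>}) (\<E> {\<zero>\<^bsub>B\<^esub>}))"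
    using abelian_monoid.zero_closed[OF abelian_group.axioms(1)[OF module.axioms(2)[OF mEE]]] .
  ultimately show ?thesis
    unfolding subcoalgebra_def tensor_induced_coalgebra[OF ctx] using s by blast
qed

text \<open>Here the inclusion of tensor squares acts as the identity. This provides the Hom-spaces
  into the additional object of the extended category.\<close>

lemma subcoalgebra_carrier: "subcoalgebra (carrier B) K B"
proof -
  note mB = B.module_axioms
  have "\<J> (carrier B) t = t" if "t \<in> carrier (tensor K B B)" for t
    unfolding tensor_square_inclusion_eq[of K B _ B B]
    by (rule tensor_map_ident[OF mB mB linear_map_id linear_map_id _ _ that]) auto
  moreover have "B\<lparr>carrier := carrier B\<rparr> = B" by simp
  ultimately show ?thesis
    unfolding subcoalgebra_def
    using B.carrier_is_submodule linear_mapsD(1)[OF B.comult_linear] by force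
qed

text \<open>The common reduction for both categories. The associativity and unit laws are inherited
  from the ring \<open>B\<close>, and the coalgebra conditions come from the preceding lemmas,
  leaving closure conditions on the spaces \<open>S x y\<close>.\<close>

lemma semi_hopf_category_subcoalgebras:
  assumes S: "\<And>x y. \<lbrakk>x \<in> A; y \<in> A\<rbrakk> \<Longrightarrow> subcoalgebra (S x y) K B"
    and one: "\<And>x. x \<in> A \<Longrightarrow> \<one>\<^bsub>B\<^esub> \<in> S x x"
    and mult: "\<And>x y z g f. \<lbrakk>x \<in> A; y \<in> A; z \<in> A; g \<in> S y z; f \<in> S x y\<rbrakk> \<Longrightarrow> g \<otimes>\<^bsub>B\<^esub> f \<in> S x z"
  shows "semi_hopf_category K \<lparr>Obj = A, Hom = (\<lambda>x y. induced_coalgebra K B (S x y)),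
    cmp = (\<lambda>_ _ _ g f. g \<otimes>\<^bsub>B\<^esub> f), ident = (\<lambda>_. \<one>\<^bsub>B\<^esub>)\<rparr>"
proof -
  have car: "f \<in> carrier B" if "x \<in> A" "y \<in> A" "f \<in> S x y" for x y f
    using B.submoduleE(1)[OF submodule_subcoalgebra[OF S[OF that(1,2)]]] that(3) by auto
  note hom = subcoalgebra_mult_coalgebra_hom[OF S S S mult]
  show ?thesis
  proof (rule semi_hopf_category.intro[OF B.K.field_axioms], rule semi_hopf_category_axioms.intro,
      unfold coalgebra_category.simps, goal_cases)
    case (1 x y)
    then show ?case by (intro coalgebra_induced_coalgebra B.coalgebra_axioms S)
  next
    case (2 x y z)
    then show ?case by (intro hom(1))
  next
    case (3 x)
    then show ?case by (simp add: one)
  next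
    case (4 w x y z f g h)
    then show ?case using car by (auto intro!: B.B.m_assoc)
  next
    case (5 x y f)
    then show ?case using car by (auto intro!: B.B.l_one)
  next
    case (6 x y f)
    then show ?case using car by (auto intro!: B.B.r_one)
  next
    case (7 x y z)
    then show ?case by (intro hom(2))
  next
    case (8 x)
    then show ?case by (intro subcoalgebra_unit_coalgebra_hom S one)
  qed
qed

end

section \<open>The companion categories\<close>

theorem proposition9p2:
  fixes K :: "('k, 'm) ring_scheme"
    and \<Gamma> :: "('g, 'n) monoid_scheme"
    and leq :: "'g rel"
    and B :: "('k, 'b) coalgebra"
    and F :: "'g \<Rightarrow> 'b set"
    and \<Lambda> :: "'g set"
  assumes "field K"
    and "ordered_group \<Gamma> leq"
    and "bialgebra K B"
    and "bialgebra_filtration \<Gamma> leq K B F"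
    and "\<Lambda> \<subseteq> carrier \<Gamma>"
  shows "semi_hopf_category K (filtered_companion \<Gamma> leq K B F \<Lambda>) \<and>
         semi_hopf_category K (extended_companion \<Gamma> leq K B F \<Lambda>)"
proof -
  interpret B: bialgebra K B by fact
  interpret \<Gamma>: ordered_group \<Gamma> leq by fact
  interpret F: bialgebra_filtration \<Gamma> leq K B F by fact
  let ?S = "companion_space \<Gamma> leq B F"
  note po = \<Gamma>.leq_partial_order
  have refl: "(\<alpha>, \<alpha>) \<in> leq" if "\<alpha> \<in> carrier \<Gamma>" for \<alpha>
    using po that by (auto simp: partial_order_on_def preorder_on_def refl_on_def)
  have trans: "(\<alpha>, \<gamma>) \<in> leq" if "(\<alpha>, \<beta>) \<in> leq" "(\<beta>, \<gamma>) \<in> leq" for \<alpha> \<beta> \<gamma>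
    using po that by (auto simp: partial_order_on_def preorder_on_def dest: transD)
  \<comment> \<open>Multiplying \<open>\<alpha> \<le> \<beta>\<close> on the right by the inverse of
    \<open>\<alpha>\<close>, compared with itself by reflexivity, puts the index above the neutral
    element.\<close>
  have nonneg: "\<beta> \<otimes>\<^bsub>\<Gamma>\<^esub> inv\<^bsub>\<Gamma>\<^esub> \<alpha> \<in> nonneg_elements \<Gamma> leq"
    if "\<alpha> \<in> carrier \<Gamma>" "\<beta> \<in> carrier \<Gamma>" "(\<alpha>, \<beta>) \<in> leq" for \<alpha> \<beta>
    using \<Gamma>.mult_mono[OF that(3) refl[of "inv\<^bsub>\<Gamma>\<^esub> \<alpha>"]] that(1,2)
    by (simp add: nonneg_elements_def)
  have sub: "subcoalgebra (?S \<alpha> \<beta>) K B" if "\<alpha> \<in> carrier \<Gamma>" "\<beta> \<in> carrier \<Gamma>" for \<alpha> \<beta>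
    using F.filtration_subbialgebra[OF nonneg[OF that]] subcoalgebra_zero[OF \<open>bialgebra K B\<close>]
    by (auto simp: companion_space_def subbialgebra_def)
  have zero: "\<zero>\<^bsub>B\<^esub> \<in> ?S \<alpha> \<beta>" if "\<alpha> \<in> carrier \<Gamma>" "\<beta> \<in> carrier \<Gamma>" for \<alpha> \<beta>
    using subgroup.one_closed[OF submodule.axioms(1)[OF submodule_subcoalgebra[OF sub[OF that]]]] by simp
  have car: "f \<in> carrier B" if "f \<in> ?S \<alpha> \<beta>" "\<alpha> \<in> carrier \<Gamma>" "\<beta> \<in> carrier \<Gamma>" for f \<alpha> \<beta>
    using B.submoduleE(1)[OF submodule_subcoalgebra[OF sub[OF that(2,3)]]] that(1) by auto
  have one: "\<one>\<^bsub>B\<^esub> \<in> ?S \<alpha> \<alpha>" if "\<alpha> \<in> carrier \<Gamma>" for \<alpha>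
    using F.filtration_subbialgebra[OF nonneg[OF that that refl[OF that]]] refl[OF that]
    by (auto simp: companion_space_def subbialgebra_def dest: subringE(3))
  have mult: "g \<otimes>\<^bsub>B\<^esub> f \<in> ?S \<alpha> \<gamma>"
    if "\<alpha> \<in> carrier \<Gamma>" "\<beta> \<in> carrier \<Gamma>" "\<gamma> \<in> carrier \<Gamma>" "g \<in> ?S \<beta> \<gamma>" "f \<in> ?S \<alpha> \<beta>" for \<alpha> \<beta> \<gamma> g f
  proof (cases "(\<alpha>, \<beta>) \<in> leq \<and> (\<beta>, \<gamma>) \<in> leq")
    case True
    \<comment> \<open>The index of \<open>g\<close> stands on the left, as \<open>g\<close> does in
      the product. In a noncommutative group this order is what lets the inner factors
      cancel.\<close>
    have "(\<gamma> \<otimes>\<^bsub>\<Gamma>\<^esub> inv\<^bsub>\<Gamma>\<^esub> \<beta>) \<otimes>\<^bsub>\<Gamma>\<^esub> (\<beta> \<otimes>\<^bsub>\<Gamma>\<^esub> inv\<^bsub>\<Gamma>\<^esub> \<alpha>) = \<gamma> \<otimes>\<^bsub>\<Gamma>\<^esub> inv\<^bsub>\<Gamma>\<^esub> \<alpha>"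
      using that(1-3) by (simp add: \<Gamma>.m_assoc \<Gamma>.inv_solve_left')
    then show ?thesis
      using True trans[of \<alpha> \<beta> \<gamma>] that(4,5)
        F.filtration_mult[OF nonneg[OF that(2,3)] nonneg[OF that(1,2)], of g f]
      by (simp add: companion_space_def)
  next
    case False
    \<comment> \<open>A missing comparison makes one of the two spaces zero. The product then
      vanishes, even if \<open>\<alpha> \<le> \<gamma>\<close> happens to hold, and zero lies in the
      target space.\<close>
    then have "g = \<zero>\<^bsub>B\<^esub> \<or> f = \<zero>\<^bsub>B\<^esub>" using that(4,5) by (auto simp: companion_space_def)
    then have "g \<otimes>\<^bsub>B\<^esub> f = \<zero>\<^bsub>B\<^esub>" using car that by auto
    then show ?thesis using zero that by simp
  qed
  have \<Lambda>: "\<alpha> \<in> \<Lambda> \<Longrightarrow> \<alpha> \<in> carrier \<Gamma>" for \<alpha> using assms(5) by auto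
  have "semi_hopf_category K (filtered_companion \<Gamma> leq K B F \<Lambda>)"
    unfolding filtered_companion_def
    by (intro semi_hopf_category_subcoalgebras assms(3)) (auto intro: \<Lambda> sub one mult)
  moreover have "semi_hopf_category K (extended_companion \<Gamma> leq K B F \<Lambda>)"
    unfolding extended_companion_def
  proof (intro semi_hopf_category_subcoalgebras assms(3))
    let ?O = "insert None (Some ` \<Lambda>)" and ?T = "extended_companion_space \<Gamma> leq B F"
    fix x assume x: "x \<in> ?O"
    show "\<one>\<^bsub>B\<^esub> \<in> ?T x x" using x \<Lambda> one by (cases x) auto
    fix y assume y: "y \<in> ?O"
    show "subcoalgebra (?T x y) K B"
      using x y \<Lambda> sub subcoalgebra_zero[OF assms(3)] subcoalgebra_carrier[OF assms(3)]
      by (cases x; cases y) auto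
    fix z g f assume z: "z \<in> ?O" and g: "g \<in> ?T y z" and f: "f \<in> ?T x y"
    have "f \<in> carrier B" using f x y car \<Lambda> by (cases x; cases y) auto
    moreover have "g \<in> carrier B" using g y z car \<Lambda> by (cases y; cases z) auto
    \<comment> \<open>If \<open>z\<close> is the additional object, the target is all of
      \<open>B\<close>. If \<open>z\<close> is an ordinary object but \<open>x\<close> or
      \<open>y\<close> is not, then \<open>f\<close> or \<open>g\<close> leaves the additional
      object for an ordinary one and is zero. The remaining case is \<open>mult\<close>.\<close>
    ultimately show "g \<otimes>\<^bsub>B\<^esub> f \<in> ?T x z"
      using x y z g f \<Lambda> zero by (cases x; cases y; cases z) (auto intro: mult)
  qed
  ultimately show ?thesis ..
qed

end
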